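(* Let $d$ and $r$ be integers satisfying $d\ge1$ and $2\le r\le d+1$, and let $\mathcal{K}_{d,r}$ be the set of all abelian groups of order $2^{2d-r+2}$, rank $r$, and exponent at most $2^{d-r+2}$. Then for each $K\in\mathcal{K}_{d,r}$ there exists a signature set on $K$ with respect to the unique subgroup of $K$ isomorphic to $C_2^r$.
   Context: The rank of a finite abelian group is its minimal number of generators. For $A=\sum a_g g\in\mathbb{Z}K$, $A^{(-1)}=\sum a_g g^{-1}$. Let $E=\langle x_1,\dots,x_r\rangle\cong C_2^r$ be a (normal) subgroup of $K$, $U_r=\mathrm{GF}(2)^r$, and for $u\in U_r$ let $\chi_u=\prod_{i=1}^r(1+(-1)^{u_i}x_i)\in\mathbb{Z}E$ (the characters of $E$). A signature block on $K$ with respect to $\chi_u$ is an element $A_u\in\mathbb{Z}K$ that is $\{\pm1\}$-valued on some set of coset representatives for $E$ in $K$ (one element from each coset) and zero elsewhere, satisfying $A_u\chi_uA_u^{(-1)}=\frac{|K|}{2^r}\chi_u$ in $\mathbb{Z}K$. A signature set on $K$ with respect to $E$ is a multiset $\{A_u:u\in U_r\}$ where each $A_u$ is a signature block with respect to $\chi_u$. *)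

theory Defs
  imports "HOL-Algebra.Algebra" "HOL-Library.Z2" "HOL-Library.Multiset"
begin

definition group_rank :: "('a, 'b) monoid_scheme \<Rightarrow> nat" where
  "group_rank G =
     (LEAST n. \<exists>S. S \<subseteq> carrier G \<and> finite S \<and> card S = n \<and> generate G S = carrier G)"

definition group_exponent :: "('a, 'b) monoid_scheme \<Rightarrow> nat" where
  "group_exponent G = (LEAST n. 0 < n \<and> (\<forall>g \<in> carrier G. g [^]\<^bsub>G\<^esub> n = \<one>\<^bsub>G\<^esub>))"

definition C2_power :: "nat \<Rightarrow> (nat \<Rightarrow> int) monoid" where
  "C2_power r = product_group {1..r} (\<lambda>_. integer_mod_group 2)"

(* The integral group ring ZG. Its elements are finitely supported functions on the ambient type
   that vanish outside carrier G, so for a subgroup E of G the ring ZE, taken as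
   group_ring (G\<lparr>carrier := E\<rparr>), is literally contained in ZG. *)
definition group_ring :: "('a, 'b) monoid_scheme \<Rightarrow> ('a \<Rightarrow> int) ring" where
  "group_ring G = \<lparr>
     carrier = {A. finite {g. A g \<noteq> 0} \<and> {g. A g \<noteq> 0} \<subseteq> carrier G},
     monoid.mult = (\<lambda>A B g. \<Sum>(h, k) \<in> {(h, k). A h \<noteq> 0 \<and> B k \<noteq> 0 \<and> h \<otimes>\<^bsub>G\<^esub> k = g}. A h * B k),
     one = (\<lambda>g. of_bool (g = \<one>\<^bsub>G\<^esub>)),
     ring.zero = (\<lambda>_. 0),
     ring.add = (\<lambda>A B g. A g + B g)\<rparr>"

definition gr_inv :: "('a, 'b) monoid_scheme \<Rightarrow> ('a \<Rightarrow> int) \<Rightarrow> ('a \<Rightarrow> int)" where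
  "gr_inv G A = (\<lambda>g. if g \<in> carrier G then A (inv\<^bsub>G\<^esub> g) else 0)"

definition U :: "nat \<Rightarrow> (nat \<Rightarrow> bit) set" where
  "U r = {1..r} \<rightarrow>\<^sub>E UNIV"

(* The product over i of 1 + (-1)^(u i) x_i, formed in the commutative ring ZE.
   The exponent of_bool (u i = 1) is the representative of u i in {0, 1}. *)
definition chi ::
  "('a, 'b) monoid_scheme \<Rightarrow> 'a set \<Rightarrow> nat \<Rightarrow> (nat \<Rightarrow> 'a) \<Rightarrow> (nat \<Rightarrow> bit) \<Rightarrow> ('a \<Rightarrow> int)" where
  "chi K E r x u =
     finprod (group_ring (K\<lparr>carrier := E\<rparr>))
       (\<lambda>i g. of_bool (g = \<one>\<^bsub>K\<^esub>) + (- 1) ^ of_bool (u i = 1) * of_bool (g = x i)) {1..r}"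

definition coset_representatives :: "('a, 'b) monoid_scheme \<Rightarrow> 'a set \<Rightarrow> 'a set \<Rightarrow> bool" where
  "coset_representatives K E T \<longleftrightarrow>
     T \<subseteq> carrier K \<and> (\<forall>C \<in> rcosets\<^bsub>K\<^esub> E. \<exists>!t. t \<in> T \<inter> C)"

(* For finite K and E a subgroup of order 2^r, the division below is exact. *)
definition signature_block ::
  "('a, 'b) monoid_scheme \<Rightarrow> 'a set \<Rightarrow> nat \<Rightarrow> (nat \<Rightarrow> 'a) \<Rightarrow> (nat \<Rightarrow> bit) \<Rightarrow> ('a \<Rightarrow> int) \<Rightarrow> bool" where
  "signature_block K E r x u A \<longleftrightarrow>
     A \<in> carrier (group_ring K) \<and>
     (\<exists>T. coset_representatives K E T \<and> (\<forall>g \<in> T. A g \<in> {1, -1}) \<and> (\<forall>g. g \<notin> T \<longrightarrow> A g = 0)) \<and>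
     A \<otimes>\<^bsub>group_ring K\<^esub> chi K E r x u \<otimes>\<^bsub>group_ring K\<^esub> gr_inv K A
       = (\<lambda>g. int (order K div 2 ^ r) * chi K E r x u g)"

(* The characters chi_u, and hence the indexing of a signature set, refer to a tuple x_1, ..., x_r
   of generators of E; another choice of generators only permutes the chi_u. *)
definition signature_set ::
  "('a, 'b) monoid_scheme \<Rightarrow> 'a set \<Rightarrow> nat \<Rightarrow> (nat \<Rightarrow> 'a) \<Rightarrow> ('a \<Rightarrow> int) multiset \<Rightarrow> bool" where
  "signature_set K E r x M \<longleftrightarrow>
     (\<exists>A. M = image_mset A (mset_set (U r)) \<and> (\<forall>u \<in> U r. signature_block K E r x u (A u)))"

definition C2_power_subgroup :: "('a, 'b) monoid_scheme \<Rightarrow> nat \<Rightarrow> 'a set \<Rightarrow> bool" where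
  "C2_power_subgroup K r E \<longleftrightarrow> subgroup E K \<and> K\<lparr>carrier := E\<rparr> \<cong> C2_power r"

end

theory Submission
  imports Defs
begin

text \<open>
  Let \<open>P\<close> be a subgroup of an abelian group \<open>H\<close> and \<open>\<psi>\<close> a \<open>\<plusminus>1\<close>-valued character of \<open>P\<close>. Extending a
  signature block from its transversal by \<open>f (p x) = \<psi> p * f x\<close> turns the group ring equation into
  the vanishing of the autocorrelation of \<open>f\<close> off \<open>P\<close>, so that no complex characters are needed.
  Such an \<open>f\<close> exists whenever \<open>H / P\<close> has order \<open>4 ^ n\<close> and exponent dividing \<open>2 ^ n\<close>, by induction
  on \<open>n\<close>: choose \<open>e \<in> H - P\<close> with \<open>\<psi> (e\<^sup>2) = 1\<close> and a subgroup \<open>K\<close> of index 2 in \<open>H\<close> such that \<open>K\<close> modulo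
  \<open>P\<^sub>1 = P \<union> P e\<close> has exponent dividing \<open>2 ^ (n - 1)\<close>. The functions on \<open>K\<close> that belong to
  the two extensions of \<open>\<psi>\<close> to \<open>P\<^sub>1\<close>, placed on the two cosets of \<open>K\<close>, form the required function: their
  autocorrelations cancel on the coset \<open>P e\<close>, and their cross-correlations vanish because one function is invariant
  under \<open>e\<close> and the other changes sign. The hypotheses on rank, order and exponent
  give the case where \<open>P\<close> is the group of elements of order at most 2 and \<open>n = d + 1 - r\<close>.
\<close>

subsection \<open>Subgroups of index two\<close>

context group
begin

lemma subgroup_nat_pow_closed:
  assumes "subgroup H G" "x \<in> H"
  shows "x [^] (n::nat) \<in> H"
  by (induction n) (use assms subgroup.one_closed subgroup.m_closed in auto)

text \<open>The fibres of \<open>g\<close> on \<open>H\<close> are cosets of \<open>Y\<close>, all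
  of size \<open>card Y\<close>. Leaving \<open>g\<close> abstract lets one count serve both coset
  maps and the squaring map.\<close>

lemma card_eq_index_mult:
  assumes H: "subgroup H G" and fin: "finite H" and Y: "subgroup Y G" and YX: "Y \<subseteq> H"
    and g: "\<And>x y. x \<in> H \<Longrightarrow> y \<in> H \<Longrightarrow> g x = g y \<longleftrightarrow> x \<otimes> inv y \<in> Y"
  shows "card H = card (g ` H) * card Y"
proof -
  interpret H: subgroup H G by fact
  interpret Y: subgroup Y G by fact
  have fib: "card {x \<in> H. g x = v} = card Y" if "v \<in> g ` H" for v
  proof -
    from that obtain y where y: "y \<in> H" "v = g y" by auto
    have "{x \<in> H. g x = v} = (\<lambda>k. k \<otimes> y) ` Y"
    proof safe
      fix x assume x: "x \<in> H" "v = g x"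
      then have "x \<otimes> inv y \<in> Y" using g[of x y] y by simp
      moreover have "x = (x \<otimes> inv y) \<otimes> y" using x y by (simp add: m_assoc)
      ultimately show "x \<in> (\<lambda>k. k \<otimes> y) ` Y" by blast
    next
      fix k assume k: "k \<in> Y"
      then show kx: "k \<otimes> y \<in> H" using y YX by auto
      show "g (k \<otimes> y) = v" using g[of "k \<otimes> y" y] kx k y by (simp add: m_assoc)
    qed
    moreover have "inj_on (\<lambda>k. k \<otimes> y) Y" using y by (auto simp: inj_on_def)
    ultimately show ?thesis by (simp add: card_image)
  qed
  have "card H = (\<Sum>v\<in>g ` H. card {x \<in> H. g x = v})"
    using sum.image_gen[OF fin, of "\<lambda>_. 1::nat" g] by simp
  also have "\<dots> = card (g ` H) * card Y" using fib by simp
  finally show ?thesis .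
qed

lemma r_coset_eq_iff:
  assumes "subgroup Y G" "a \<in> carrier G" "b \<in> carrier G"
  shows "Y #> a = Y #> b \<longleftrightarrow> a \<otimes> inv b \<in> Y"
proof
  interpret Y: subgroup Y G by fact
  assume "Y #> a = Y #> b"
  then have "a \<in> Y #> b" using assms rcos_self by blast
  then show "a \<otimes> inv b \<in> Y" using assms by (auto simp: r_coset_def m_assoc)
next
  interpret Y: subgroup Y G by fact
  assume "a \<otimes> inv b \<in> Y"
  moreover have "a = (a \<otimes> inv b) \<otimes> b" using assms by (simp add: m_assoc)
  ultimately have "a \<in> Y #> b" unfolding r_coset_def by blast
  then show "Y #> a = Y #> b" using repr_independence assms by metis
qed

lemma card_subgroup_dvd:
  assumes "subgroup H G" "finite H" "subgroup Y G" "Y \<subseteq> H"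
  shows "card Y dvd card H"
  using card_eq_index_mult[OF assms, of "\<lambda>x. Y #> x"] assms r_coset_eq_iff subgroup.mem_carrier
  by (metis dvd_triv_right)

text \<open>With denominators cleared, this compares the index of the preimage of \<open>Y'\<close>
  in \<open>H\<close> with the index of \<open>Y'\<close> in \<open>Y\<close>: \<open>h\<close>
  induces an injection from the cosets of the former into the cosets of the latter.\<close>

lemma index_preimage_le:
  assumes H: "subgroup H G" and Y: "subgroup Y G" and fin: "finite H" "finite Y"
    and Y': "subgroup Y' G" "Y' \<subseteq> Y"
    and h: "\<And>x. x \<in> H \<Longrightarrow> h x \<in> Y"
      "\<And>x y. x \<in> H \<Longrightarrow> y \<in> H \<Longrightarrow> h (x \<otimes> inv y) = h x \<otimes> inv (h y)"
    and H': "subgroup {x \<in> H. h x \<in> Y'} G"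
  shows "card H * card Y' \<le> card Y * card {x \<in> H. h x \<in> Y'}"
proof -
  interpret H: subgroup H G by fact
  interpret Y: subgroup Y G by fact
  let ?H' = "{x \<in> H. h x \<in> Y'}"
  have 1: "card H = card ((\<lambda>x. Y' #> h x) ` H) * card ?H'"
    using h Y' by (intro card_eq_index_mult H fin H') (auto simp: r_coset_eq_iff)
  have 2: "card Y = card ((\<lambda>y. Y' #> y) ` Y) * card Y'"
    using Y' by (intro card_eq_index_mult Y fin) (auto simp: r_coset_eq_iff)
  have "card ((\<lambda>x. Y' #> h x) ` H) \<le> card ((\<lambda>y. Y' #> y) ` Y)"
    using h fin by (intro card_mono) auto
  then show ?thesis unfolding 1 2 by (simp add: mult_ac)
qed

end

context comm_group
begin

lemma subgroup_nat_pow_preimage: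
  assumes "subgroup H G" "subgroup Y G"
  shows "subgroup {x \<in> H. x [^] (n::nat) \<in> Y} G"
proof -
  interpret H: subgroup H G by fact
  interpret Y: subgroup Y G by fact
  show ?thesis
  proof (rule subgroupI)
    show "{x \<in> H. x [^] n \<in> Y} \<noteq> {}" using H.one_closed Y.one_closed by (auto intro!: exI[of _ \<one>])
  qed (auto simp: nat_pow_inv pow_mult_distrib m_comm)
qed

text \<open>Two cosets suffice because the square of \<open>e\<close> lies in \<open>P\<close>;
  inverses stay inside since the inverse of \<open>e\<close> is e^-2 e.\<close>

lemma subgroup_adjoin:
  assumes "subgroup P G" "e \<in> carrier G" "e \<otimes> e \<in> P"
  shows "subgroup (P \<union> (P #> e)) G"
proof -
  interpret P: subgroup P G by fact
  have ie: "inv e = inv (e \<otimes> e) \<otimes> e" using assms by (simp add: inv_mult_group m_assoc)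
  show ?thesis
  proof (rule subgroupI)
    show "P \<union> (P #> e) \<subseteq> carrier G" using assms r_coset_subset_G P.subset by auto
    show "P \<union> (P #> e) \<noteq> {}" using P.one_closed by blast
  next
    fix a assume "a \<in> P \<union> (P #> e)"
    then show "inv a \<in> P \<union> (P #> e)"
    proof
      assume "a \<in> P #> e"
      then obtain p where p: "p \<in> P" "a = p \<otimes> e" by (auto simp: r_coset_def)
      then have "inv a = inv p \<otimes> inv e" using assms(2) by (simp add: inv_mult)
      also have "\<dots> = inv p \<otimes> (inv (e \<otimes> e) \<otimes> e)" using ie by (rule arg_cong)
      also have "\<dots> = (inv p \<otimes> inv (e \<otimes> e)) \<otimes> e"
        using assms(2) p by (intro m_assoc[symmetric]) auto
      finally have "inv a = (inv p \<otimes> inv (e \<otimes> e)) \<otimes> e" .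
      moreover have "inv p \<otimes> inv (e \<otimes> e) \<in> P" using p assms by simp
      ultimately show ?thesis by (auto simp: r_coset_def)
    qed simp
  next
    fix a b assume "a \<in> P \<union> (P #> e)" "b \<in> P \<union> (P #> e)"
    then consider "a \<in> P" "b \<in> P" | p where "a \<in> P" "p \<in> P" "b = p \<otimes> e"
      | p where "p \<in> P" "a = p \<otimes> e" "b \<in> P"
      | p q where "p \<in> P" "a = p \<otimes> e" "q \<in> P" "b = q \<otimes> e"
      by (auto simp: r_coset_def)
    then show "a \<otimes> b \<in> P \<union> (P #> e)"
    proof cases
      case (2 p)
      then have "a \<otimes> b = (a \<otimes> p) \<otimes> e" using assms by (simp add: m_assoc)
      then show ?thesis using 2 P.m_closed[of a p] unfolding r_coset_def by blast
    next
      case (3 p)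
      then have "a \<otimes> b = (p \<otimes> b) \<otimes> e" using assms by (simp add: m_ac)
      then show ?thesis using 3 P.m_closed[of p b] unfolding r_coset_def by blast
    next
      case (4 p q)
      then have "a \<otimes> b = (p \<otimes> q) \<otimes> (e \<otimes> e)" using assms by (simp add: m_ac)
      then show ?thesis using 4 assms by simp
    qed simp
  qed
qed

lemma adjoin_mem:
  assumes "subgroup P G" "e \<in> carrier G"
  shows "e \<in> P \<union> (P #> e)"
  using rcos_self[OF assms(2,1)] by (rule UnI2)

lemma adjoin_subset:
  assumes "subgroup H G" "P \<subseteq> H" "e \<in> H"
  shows "P \<union> (P #> e) \<subseteq> H"
  using assms by (auto simp: r_coset_def subgroup.m_closed)

lemma r_coset_disjoint:
  assumes "subgroup P G" "e \<in> carrier G" "e \<notin> P"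
  shows "P \<inter> (P #> e) = {}"
proof -
  interpret P: subgroup P G by fact
  have "e \<in> P" if p: "p \<in> P" "p \<otimes> e \<in> P" for p
  proof -
    have "inv p \<otimes> (p \<otimes> e) \<in> P" using that by simp
    then show ?thesis using p assms by (simp add: m_assoc[symmetric])
  qed
  then show ?thesis using assms(3) by (auto simp: r_coset_def)
qed

lemma card_r_coset:
  assumes "P \<subseteq> carrier G" "e \<in> carrier G"
  shows "card (P #> e) = card P"
proof -
  have "P #> e = (\<lambda>p. p \<otimes> e) ` P" by (auto simp: r_coset_def)
  moreover have "inj_on (\<lambda>p. p \<otimes> e) P" using assms by (intro inj_onI) (metis r_cancel subsetD)
  ultimately show ?thesis by (simp add: card_image)
qed

lemma card_adjoin:
  assumes "subgroup P G" "finite P" "e \<in> carrier G" "e \<notin> P"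
  shows "card (P \<union> (P #> e)) = 2 * card P"
proof -
  have "finite (P #> e)" using assms(2) by (simp add: r_coset_def)
  then have "card (P \<union> (P #> e)) = card P + card (P #> e)"
    using assms by (intro card_Un_disjoint) (auto dest: r_coset_disjoint)
  then show ?thesis
    using card_r_coset[of P e] assms subgroup.subset[OF assms(1)] by simp
qed

text \<open>A proper subgroup \<open>Y\<close> of largest size among those containing
  \<open>P\<close> works. Repeated squaring of an element outside \<open>Y\<close> yields some
  \<open>e\<close> outside \<open>Y\<close> whose square is in \<open>Y\<close>; adjoining
  \<open>e\<close> doubles \<open>Y\<close> and by maximality gives all of \<open>H\<close>.\<close>

lemma index_two_subgroup:
  assumes H: "subgroup H G" "finite H" and P: "subgroup P G" "P \<subseteq> H" "P \<noteq> H"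
    and pow: "\<And>x. x \<in> H \<Longrightarrow> x [^] (2 ^ n :: nat) \<in> P"
  shows "\<exists>Y. subgroup Y G \<and> P \<subseteq> Y \<and> Y \<subseteq> H \<and> card H = 2 * card Y"
proof -
  interpret H: subgroup H G by fact
  define F where "F = {Y. subgroup Y G \<and> P \<subseteq> Y \<and> Y \<subset> H}"
  have "finite F" "F \<noteq> {}" using H P by (auto simp: F_def intro: finite_subset[of _ "Pow H"])
  then have "Max (card ` F) \<in> card ` F" by (intro Max_in) auto
  then obtain Y where Y: "Y \<in> F" "card Y = Max (card ` F)" by auto
  have max: "card Z \<le> card Y" if "Z \<in> F" for Z
    using that Y(2) \<open>finite F\<close> by simp
  from Y(1) have Ys: "subgroup Y G" "P \<subseteq> Y" "Y \<subset> H" by (auto simp: F_def)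
  then obtain y where y: "y \<in> H" "y \<notin> Y" by auto
  \<comment> \<open>Since \<open>y\<close> is not in \<open>Y\<close>, this \<open>k\<close> is
    positive, and \<open>e\<close>, the power of \<open>y\<close> with exponent 2^(k-1), is the last
    iterated square before \<open>Y\<close> is entered.\<close>
  define k where "k = (LEAST k. y [^] (2 ^ k :: nat) \<in> Y)"
  have k: "y [^] (2 ^ k :: nat) \<in> Y" unfolding k_def
    by (rule LeastI[of _ n]) (use pow y Ys in auto)
  then obtain j where j: "k = Suc j" using y by (cases k) auto
  define e where "e = y [^] (2 ^ j :: nat)"
  have "e \<notin> Y" using not_less_Least[of j "\<lambda>k. y [^] (2 ^ k :: nat) \<in> Y"] j by (auto simp: e_def k_def)
  have eX: "e \<in> H" "e \<in> carrier G" using y subgroup_nat_pow_closed[OF H(1)] by (auto simp: e_def)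
  have ee: "e \<otimes> e \<in> Y" using k y by (simp add: e_def j nat_pow_mult mult_2)
  have sub: "subgroup (Y \<union> (Y #> e)) G" by (rule subgroup_adjoin) (use Ys eX ee in auto)
  have c: "card (Y \<union> (Y #> e)) = 2 * card Y"
    by (rule card_adjoin) (use Ys H \<open>e \<notin> Y\<close> eX finite_subset in auto)
  have incl: "Y \<union> (Y #> e) \<subseteq> H" by (rule adjoin_subset) (use Ys H eX in auto)
  have "card Y > 0" using Ys H by (metis card_gt_0_iff finite_subset psubset_imp_subset subgroup.one_closed empty_iff)
  then have "Y \<union> (Y #> e) \<notin> F" using max[of "Y \<union> (Y #> e)"] c by auto
  then have "Y \<union> (Y #> e) = H" using sub incl Ys by (auto simp: F_def)
  then show ?thesis using c Ys by (intro exI[of _ Y]) auto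
qed

end

subsection \<open>Perfect functions\<close>

text \<open>The value 0 outside \<open>P\<close> makes \<open>\<psi>\<close> an element of the group
  ring, so that \<open>chi\<close> itself can be shown to be such a character.\<close>

definition sign_character :: "('a, 'b) monoid_scheme \<Rightarrow> 'a set \<Rightarrow> ('a \<Rightarrow> int) \<Rightarrow> bool" where
  "sign_character G P \<psi> \<longleftrightarrow>
     subgroup P G \<and> (\<forall>x\<in>P. \<psi> x \<in> {1, -1}) \<and> (\<forall>x\<in>P. \<forall>y\<in>P. \<psi> (x \<otimes>\<^bsub>G\<^esub> y) = \<psi> x * \<psi> y) \<and>
     (\<forall>x. x \<notin> P \<longrightarrow> \<psi> x = 0)"

text \<open>This is the product \<open>(1 + s e) \<psi>\<close> in the group ring; for \<open>e \<notin> P\<close> it extends \<open>\<psi>\<close> to \<open>P \<union> P e\<close>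
  with the value \<open>s\<close> at \<open>e\<close>.\<close>

definition adjoin_sign :: "('a, 'b) monoid_scheme \<Rightarrow> 'a \<Rightarrow> int \<Rightarrow> ('a \<Rightarrow> int) \<Rightarrow> 'a \<Rightarrow> int" where
  "adjoin_sign G e s \<psi> x =
     (if x \<in> carrier G then \<psi> x + s * \<psi> (inv\<^bsub>G\<^esub> e \<otimes>\<^bsub>G\<^esub> x) else 0)"

text \<open>Only the values on \<open>H\<close> are constrained, so that functions on a subgroup can
  be glued into one on \<open>H\<close>. For an abelian \<open>H\<close> containing
  \<open>P\<close>, the first two conditions already fix the autocorrelation on
  \<open>P\<close>.\<close>

definition perfect_function ::
  "('a, 'b) monoid_scheme \<Rightarrow> 'a set \<Rightarrow> 'a set \<Rightarrow> ('a \<Rightarrow> int) \<Rightarrow> ('a \<Rightarrow> int) \<Rightarrow> bool" where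
  "perfect_function G H P \<psi> f \<longleftrightarrow>
     (\<forall>x\<in>H. f x \<in> {1, -1}) \<and> (\<forall>p\<in>P. \<forall>x\<in>H. f (p \<otimes>\<^bsub>G\<^esub> x) = \<psi> p * f x) \<and>
     (\<forall>y\<in>H - P. (\<Sum>x\<in>H. f x * f (x \<otimes>\<^bsub>G\<^esub> y)) = 0)"

lemma sign_square: "a * a = 1" if "a \<in> {1, -1}" for a :: int
  using that by auto

section \<open>Ratios of log-concave sequences\<close>

text \<open>The ratios c(i+1)/c(i) weakly decrease, so all are at most \<open>q\<close> once the
  first is; multiplying them gives the bound.\<close>

lemma log_concave_ratio_first:
  fixes c :: "nat \<Rightarrow> nat"
  assumes lc: "\<And>i. c (Suc (Suc i)) * c i \<le> c (Suc i) * c (Suc i)" and pos: "\<And>i. 0 < c i"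
    and c: "c 1 \<le> q * c 0"
  shows "c n \<le> q ^ n * c 0"
proof -
  have step: "c (Suc i) \<le> q * c i" for i
  proof (induction i)
    case (Suc i)
    have "c (Suc (Suc i)) * c i \<le> c (Suc i) * c (Suc i)" by (rule lc)
    also have "\<dots> \<le> (q * c i) * c (Suc i)" using Suc by (rule mult_right_mono) simp
    finally have "c (Suc (Suc i)) * c i \<le> (q * c (Suc i)) * c i" by (simp add: mult_ac)
    then show ?case using pos[of i] by simp
  qed (use c in simp)
  show ?thesis
  proof (induction n)
    case (Suc n)
    have "c (Suc n) \<le> q * c n" by (rule step)
    also have "\<dots> \<le> q * (q ^ n * c 0)" using Suc by (rule mult_left_mono) simp
    finally show ?case by (simp add: mult_ac)
  qed simp
qed

text \<open>If the last ratio exceeded \<open>q\<close>, then so would every earlier one, by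
  downward induction, and the product of all n+1 ratios would exceed q^(n+1).\<close>

lemma log_concave_ratio_last:
  fixes c :: "nat \<Rightarrow> nat"
  assumes lc: "\<And>i. c (Suc (Suc i)) * c i \<le> c (Suc i) * c (Suc i)" and pos: "\<And>i. 0 < c i"
    and c: "c (Suc n) \<le> q ^ Suc n * c 0"
  shows "c (Suc n) \<le> q * c n"
proof (rule ccontr)
  assume *: "\<not> c (Suc n) \<le> q * c n"
  have step: "q * c i < c (Suc i)" if "i \<le> n" for i
    using that
  proof (induction rule: inc_induct)
    case base
    show ?case using * by simp
  next
    case (step i)
    have "(q * c i) * c (Suc i) = (q * c (Suc i)) * c i" by (simp add: mult_ac)
    also have "\<dots> < c (Suc (Suc i)) * c i" using step.IH pos[of i] by (rule mult_strict_right_mono)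
    also have "\<dots> \<le> c (Suc i) * c (Suc i)" by (rule lc)
    finally show ?case using pos[of "Suc i"] by simp
  qed
  have "q ^ i * c 0 \<le> c i" if "i \<le> n" for i
    using that
  proof (induction i)
    case (Suc i)
    then have "q * (q ^ i * c 0) \<le> q * c i" by simp
    also have "\<dots> < c (Suc i)" using step[of i] Suc by simp
    finally show ?case by (simp add: mult_ac)
  qed simp
  from this[of n] have "q * (q ^ n * c 0) \<le> q * c n" by simp
  also have "\<dots> < c (Suc n)" using step[of n] by simp
  finally show False using c by (simp add: mult_ac)
qed

section \<open>Extending sign characters by one element\<close>

context comm_group
begin

lemma sign_character_one:
  assumes "sign_character G P \<psi>"
  shows "\<psi> \<one> = 1"
proof -
  have "\<one> \<in> P" using assms by (auto simp: sign_character_def intro: subgroup.one_closed)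
  then have "\<psi> (\<one> \<otimes> \<one>) = \<psi> \<one> * \<psi> \<one>" "\<psi> \<one> \<in> {1, -1}"
    using assms unfolding sign_character_def by blast+
  then show ?thesis by auto
qed

text \<open>Multiplicativity is at stake only for two factors from \<open>P #> e\<close>: their
  product contains the square of \<open>e\<close>, on which \<open>\<psi>\<close> is 1, in agreement
  with \<open>s * s = 1\<close>.\<close>

lemma sign_character_adjoin:
  assumes \<psi>: "sign_character G P \<psi>" and e: "e \<in> carrier G" "e \<notin> P" "e \<otimes> e \<in> P" "\<psi> (e \<otimes> e) = 1"
    and s: "s \<in> {1, -1}"
  shows "sign_character G (P \<union> (P #> e)) (adjoin_sign G e s \<psi>)"
    and "p \<in> P \<Longrightarrow> adjoin_sign G e s \<psi> p = \<psi> p"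
    and "p \<in> P \<Longrightarrow> adjoin_sign G e s \<psi> (p \<otimes> e) = s * \<psi> p"
proof -
  have P: "subgroup P G" and off: "\<And>x. x \<notin> P \<Longrightarrow> \<psi> x = 0"
    and sg: "\<And>x. x \<in> P \<Longrightarrow> \<psi> x \<in> {1, -1}"
    and mul: "\<And>x y. x \<in> P \<Longrightarrow> y \<in> P \<Longrightarrow> \<psi> (x \<otimes> y) = \<psi> x * \<psi> y"
    using \<psi> by (auto simp: sign_character_def)
  interpret P: subgroup P G by fact
  have P1: "subgroup (P \<union> (P #> e)) G" by (rule subgroup_adjoin[OF P e(1,3)])
  have rearr: "inv e \<otimes> (p \<otimes> e) = p" if "p \<in> carrier G" for p
    using that e(1) by (simp add: m_lcomm)
  have iff: "inv e \<otimes> x \<in> P \<longleftrightarrow> x \<in> P #> e" if x: "x \<in> carrier G" for x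
  proof
    assume "inv e \<otimes> x \<in> P"
    moreover have "x = (inv e \<otimes> x) \<otimes> e" using x e(1) rearr[OF x] by (simp add: m_assoc)
    ultimately show "x \<in> P #> e" unfolding r_coset_def by blast
  next
    assume "x \<in> P #> e"
    then show "inv e \<otimes> x \<in> P" using rearr by (auto simp: r_coset_def)
  qed
  have dis: "P \<inter> (P #> e) = {}" by (rule r_coset_disjoint[OF P e(1,2)])
  show A: "adjoin_sign G e s \<psi> p = \<psi> p" if "p \<in> P" for p
    using that dis iff[of p] off[of "inv e \<otimes> p"] by (auto simp: adjoin_sign_def)
  have mem: "p \<otimes> e \<in> P #> e" if "p \<in> P" for p
    using that by (auto simp: r_coset_def)
  show B: "adjoin_sign G e s \<psi> (p \<otimes> e) = s * \<psi> p" if "p \<in> P" for p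
  proof -
    have "p \<otimes> e \<notin> P" using mem[OF that] dis by blast
    then show ?thesis using that e(1) off by (simp add: adjoin_sign_def rearr)
  qed
  have ss: "s * s = 1" using s by (rule sign_square)
  show "sign_character G (P \<union> (P #> e)) (adjoin_sign G e s \<psi>)"
    unfolding sign_character_def
  proof (intro conjI ballI allI impI)
    fix x assume "x \<in> P \<union> (P #> e)"
    then consider "x \<in> P" | p where "p \<in> P" "x = p \<otimes> e" by (auto simp: r_coset_def)
    then show "adjoin_sign G e s \<psi> x \<in> {1, -1}"
    proof cases
      case (2 p)
      then show ?thesis using B[of p] sg[of p] s by auto
    qed (use A sg in auto)
  next
    fix a b assume "a \<in> P \<union> (P #> e)" "b \<in> P \<union> (P #> e)"
    then consider "a \<in> P" "b \<in> P" | p where "a \<in> P" "p \<in> P" "b = p \<otimes> e"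
      | p where "p \<in> P" "a = p \<otimes> e" "b \<in> P"
      | p q where "p \<in> P" "a = p \<otimes> e" "q \<in> P" "b = q \<otimes> e"
      by (auto simp: r_coset_def)
    then show "adjoin_sign G e s \<psi> (a \<otimes> b) = adjoin_sign G e s \<psi> a * adjoin_sign G e s \<psi> b"
    proof cases
      case 1
      then show ?thesis using A mul by simp
    next
      case (2 p)
      then have "a \<otimes> b = (a \<otimes> p) \<otimes> e" using e by (simp add: m_assoc)
      then show ?thesis using 2 A B mul by simp
    next
      case (3 p)
      then have "a \<otimes> b = (p \<otimes> b) \<otimes> e" using e by (simp add: m_ac)
      then show ?thesis using 3 A B mul by simp
    next
      case (4 p q)
      then have "a \<otimes> b = (p \<otimes> q) \<otimes> (e \<otimes> e)" using e by (simp add: m_ac)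
      then have "adjoin_sign G e s \<psi> (a \<otimes> b) = \<psi> p * \<psi> q"
        using 4 A e mul[of "p \<otimes> q" "e \<otimes> e"] mul[of p q] by simp
      also have "\<dots> = (s * s) * (\<psi> p * \<psi> q)" using ss by simp
      finally show ?thesis using 4 B by (simp add: mult_ac)
    qed
  next
    fix x assume "x \<notin> P \<union> (P #> e)"
    then show "adjoin_sign G e s \<psi> x = 0"
      using iff[of x] off[of x] off[of "inv e \<otimes> x"] by (auto simp: adjoin_sign_def)
  qed (rule P1)
qed

section \<open>The choice of \<open>e\<close> and of the subgroup of index two\<close>

text \<open>\<open>B\<close> has more than two cosets in \<open>H\<close>, so \<open>a\<close> and
  \<open>b\<close> can be taken from different nontrivial ones. If both have sign -1, then
  \<open>b \<otimes> inv a\<close> has sign 1 and still lies outside \<open>B\<close>.\<close>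

lemma sign_hom_trivial_outside:
  assumes H: "subgroup H G" "finite H" and B: "subgroup B G" "B \<subseteq> H" and big: "2 * card B < card H"
    and sg: "\<And>x. x \<in> H \<Longrightarrow> \<theta> x \<in> {1, -1 :: int}"
    and mul: "\<And>x y. x \<in> H \<Longrightarrow> y \<in> H \<Longrightarrow> \<theta> (x \<otimes> y) = \<theta> x * \<theta> y"
  shows "\<exists>x\<in>H - B. \<theta> x = 1"
proof -
  interpret H: subgroup H G by fact
  interpret B: subgroup B G by fact
  have "\<not> H \<subseteq> B" using big card_mono[OF finite_subset[OF B(2) H(2)], of H] by linarith
  then obtain a where a: "a \<in> H" "a \<notin> B" by auto
  have finB: "finite B" using B H finite_subset by auto
  have "card (B \<union> (B #> a)) \<le> card B + card (B #> a)" by (rule card_Un_le)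
  also have "\<dots> < card H" using big card_r_coset[OF B.subset, of a] a by auto
  finally have "\<not> H \<subseteq> B \<union> (B #> a)"
    using card_mono[of "B \<union> (B #> a)" H] finB by (auto simp: r_coset_def)
  then obtain b where b: "b \<in> H" "b \<notin> B" "b \<notin> B #> a" by auto
  have "b \<otimes> inv a \<notin> B"
  proof
    assume "b \<otimes> inv a \<in> B"
    moreover have "b = (b \<otimes> inv a) \<otimes> a" using a b by (simp add: m_assoc)
    ultimately show False using b(3) unfolding r_coset_def by blast
  qed
  moreover have "\<theta> (b \<otimes> inv a) = 1" if "\<theta> a = -1" "\<theta> b = -1"
    using mul[of "b \<otimes> inv a" a] a b that by (simp add: m_assoc)
  ultimately show ?thesis using a b sg[of a] sg[of b] by blast
qed

text \<open>Let B(i) be the subgroup counted by \<open>c i\<close>. Squaring maps B(i+2) into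
  B(i+1), and the preimage of B(i) is B(i+1); hence the successive indices do not increase.\<close>

lemma card_iterated_roots_log_concave:
  assumes H: "subgroup H G" "finite H" and P: "subgroup P G" "P \<subseteq> H"
  defines "c \<equiv> \<lambda>i. card {x \<in> H. x [^] (2 ^ i :: nat) \<in> P}"
  shows "c (Suc (Suc i)) * c i \<le> c (Suc i) * c (Suc i)" and "0 < c i"
proof -
  define B where "B = (\<lambda>i. {x \<in> H. x [^] (2 ^ i :: nat) \<in> P})"
  interpret H: subgroup H G by fact
  interpret P: subgroup P G by fact
  have Bs: "subgroup (B i) G" for i unfolding B_def by (rule subgroup_nat_pow_preimage[OF H(1) P(1)])
  have fin: "finite (B i)" for i unfolding B_def using H by simp
  have dbl: "(x \<otimes> x) [^] (2 ^ i :: nat) = x [^] (2 ^ Suc i :: nat)" if "x \<in> H" for x i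
    using that by (simp add: pow_mult_distrib m_comm nat_pow_mult mult_2)
  have Bsuc: "x \<otimes> x \<in> B i \<longleftrightarrow> x \<in> B (Suc i)" if "x \<in> H" for x i
    using that dbl unfolding B_def by simp
  have BH: "B i \<subseteq> H" for i by (auto simp: B_def)
  have mono: "B i \<subseteq> B (Suc i)" for i
  proof
    fix x assume x: "x \<in> B i"
    then have "x [^] (2 ^ i :: nat) \<otimes> x [^] (2 ^ i :: nat) \<in> P" by (simp add: B_def)
    then show "x \<in> B (Suc i)" using x by (simp add: B_def nat_pow_mult mult_2)
  qed
  have eq: "{x \<in> B (Suc (Suc i)). x \<otimes> x \<in> B i} = B (Suc i)"
    using Bsuc mono[of "Suc i"] BH by blast
  have "card (B (Suc (Suc i))) * card (B i) \<le> card (B (Suc i)) * card {x \<in> B (Suc (Suc i)). x \<otimes> x \<in> B i}"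
  proof (rule index_preimage_le)
    show "x \<otimes> x \<in> B (Suc i)" if "x \<in> B (Suc (Suc i))" for x
      using that Bsuc BH by blast
    show "(x \<otimes> inv y) \<otimes> (x \<otimes> inv y) = x \<otimes> x \<otimes> inv (y \<otimes> y)"
      if "x \<in> B (Suc (Suc i))" "y \<in> B (Suc (Suc i))" for x y
    proof -
      have "x \<in> carrier G" "y \<in> carrier G" using that BH H.subset by blast+
      then show ?thesis by (simp add: inv_mult m_ac)
    qed
  qed (use Bs fin mono eq in auto)
  then show "c (Suc (Suc i)) * c i \<le> c (Suc i) * c (Suc i)"
    unfolding eq by (simp add: c_def B_def)
  have "B i \<noteq> {}" using Bs subgroup.one_closed by blast
  then show "0 < c i" using fin[of i] by (simp add: c_def B_def card_gt_0_iff)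
qed

text \<open>The successive indices of the subgroups \<open>B i\<close> weakly decrease and have
  product 4^(n+1). Hence the first exceeds 2, which leaves room to choose \<open>e\<close> with sign
  1 on its square, and the last is at most 4, which keeps the index of \<open>N\<close> at most
  2.\<close>

lemma exists_descent_step:
  assumes H: "subgroup H G" "finite H" and P: "subgroup P G" "P \<subseteq> H"
    and card: "card H = 4 ^ Suc n * card P"
    and pow: "\<And>x. x \<in> H \<Longrightarrow> x [^] (2 ^ Suc n :: nat) \<in> P"
    and \<psi>: "sign_character G P \<psi>"
  shows "\<exists>e K. e \<in> H - P \<and> e \<otimes> e \<in> P \<and> \<psi> (e \<otimes> e) = 1 \<and> subgroup K G \<and>
    P \<union> (P #> e) \<subseteq> K \<and> K \<subseteq> H \<and> card H = 2 * card K \<and>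
    (\<forall>x\<in>K. x [^] (2 ^ n :: nat) \<in> P \<union> (P #> e))"
proof -
  interpret H: subgroup H G by fact
  interpret P: subgroup P G by fact
  have sg: "\<And>x. x \<in> P \<Longrightarrow> \<psi> x \<in> {1, -1}"
    and mul: "\<And>x y. x \<in> P \<Longrightarrow> y \<in> P \<Longrightarrow> \<psi> (x \<otimes> y) = \<psi> x * \<psi> y"
    using \<psi> by (auto simp: sign_character_def)
  define B where "B = (\<lambda>i. {x \<in> H. x [^] (2 ^ i :: nat) \<in> P})"
  define c where "c = (\<lambda>i. card (B i))"
  have lc: "c (Suc (Suc i)) * c i \<le> c (Suc i) * c (Suc i)" and pos: "0 < c i" for i
    using card_iterated_roots_log_concave[OF H P, of i] by (auto simp: c_def B_def)
  have Bs: "subgroup (B i) G" for i unfolding B_def by (rule subgroup_nat_pow_preimage[OF H(1) P(1)])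
  have BH: "B i \<subseteq> H" for i by (auto simp: B_def)
  have fin: "finite (B i)" for i using BH H finite_subset by blast
  have B0: "B 0 = P" using P by (auto simp: B_def)
  have Bn: "B (Suc n) = H" using pow by (auto simp: B_def)
  have cP: "0 < card P" using pos[of 0] by (simp add: c_def B0)
  have last: "card H \<le> 4 * card (B n)"
    using log_concave_ratio_last[of c n 4, OF lc pos] card by (simp add: c_def B0 Bn)
  have "\<not> c 1 \<le> 2 * c 0"
  proof
    assume "c 1 \<le> 2 * c 0"
    from log_concave_ratio_first[of c, OF lc pos this, of "Suc n"]
    have "4 ^ Suc n * card P \<le> 2 ^ Suc n * card P" using card by (simp add: c_def B0 Bn)
    then have "(4::nat) ^ Suc n \<le> 2 ^ Suc n" using cP by simp
    moreover have "(2::nat) ^ Suc n < 4 ^ Suc n" by (rule power_strict_mono) auto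
    ultimately show False by simp
  qed
  then have first: "2 * card P < card (B 1)" by (simp add: c_def B0)
  have dbl: "x [^] (2 ^ n :: nat) \<otimes> x [^] (2 ^ n :: nat) = x [^] (2 ^ Suc n :: nat)" if "x \<in> H" for x
    using that by (simp add: nat_pow_mult mult_2)
  \<comment> \<open>If the \<open>2 ^ n\<close>-th powers have more than two elements modulo \<open>P\<close>, then \<open>e\<close> must be one of them,
    so that at most two remain modulo \<open>P\<^sub>1\<close>; otherwise every admissible \<open>e\<close> will do.\<close>
  obtain e where e: "e \<in> H - P" "e \<otimes> e \<in> P" "\<psi> (e \<otimes> e) = 1"
    and big: "2 * card (B n) < card H \<Longrightarrow> \<exists>x\<in>H - B n. e = x [^] (2 ^ n :: nat)"
  proof (cases "2 * card (B n) < card H")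
    case True
    \<comment> \<open>The sign homomorphism sends \<open>x\<close> to the sign of its 2^(n+1)-th
      power, which is the square of the intended \<open>e\<close>; \<open>x\<close> outside
      \<open>B n\<close> means that \<open>e\<close> is outside \<open>P\<close>.\<close>
    have "\<exists>x\<in>H - B n. \<psi> (x [^] (2 ^ Suc n :: nat)) = 1"
    proof (rule sign_hom_trivial_outside[OF H Bs BH True])
      fix x y assume "x \<in> H" "y \<in> H"
      then show "\<psi> ((x \<otimes> y) [^] (2 ^ Suc n :: nat)) =
          \<psi> (x [^] (2 ^ Suc n :: nat)) * \<psi> (y [^] (2 ^ Suc n :: nat))"
        using mul pow by (simp add: pow_mult_distrib m_comm del: power_Suc)
    qed (use sg pow in blast)
    then obtain x where x: "x \<in> H - B n" "\<psi> (x [^] (2 ^ Suc n :: nat)) = 1" by blast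
    show ?thesis
    proof (rule that[of "x [^] (2 ^ n :: nat)"])
      show "x [^] (2 ^ n :: nat) \<in> H - P"
        using x subgroup_nat_pow_closed[OF H(1), of x] by (auto simp: B_def)
    qed (use x dbl pow in auto)
  next
    case False
    have sq: "x \<otimes> x \<in> P" if "x \<in> B 1" for x using that by (auto simp: B_def numeral_2_eq_2)
    \<comment> \<open>Here the sign homomorphism is squaring from \<open>B 1\<close> to
      \<open>P\<close> followed by \<open>\<psi>\<close>, and the subgroup to be avoided is
      \<open>P\<close>.\<close>
    have "\<exists>x\<in>B 1 - P. \<psi> (x \<otimes> x) = 1"
    proof (rule sign_hom_trivial_outside[OF Bs fin P(1) _ first])
      show "P \<subseteq> B 1" using P by (auto simp: B_def numeral_2_eq_2)
      fix x y assume xy: "x \<in> B 1" "y \<in> B 1"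
      then have "x \<in> carrier G" "y \<in> carrier G" using BH H.subset by blast+
      then have "(x \<otimes> y) \<otimes> (x \<otimes> y) = (x \<otimes> x) \<otimes> (y \<otimes> y)" by (simp add: m_ac)
      then show "\<psi> ((x \<otimes> y) \<otimes> (x \<otimes> y)) = \<psi> (x \<otimes> x) * \<psi> (y \<otimes> y)"
        using mul sq xy by simp
    qed (use sg sq in blast)
    then show ?thesis using that sq False BH by blast
  qed
  define P1 where "P1 = P \<union> (P #> e)"
  have eG: "e \<in> carrier G" using e by auto
  have P1: "subgroup P1 G" unfolding P1_def by (rule subgroup_adjoin) (use P e eG in auto)
  interpret P1: subgroup P1 G by fact
  have PP1: "P \<subseteq> P1" "e \<in> P1" using adjoin_mem[OF P(1) eG] by (auto simp: P1_def)
  have P1H: "P1 \<subseteq> H" unfolding P1_def by (rule adjoin_subset) (use H P e in auto)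
  have cP1: "card P1 = 2 * card P" unfolding P1_def
    by (rule card_adjoin) (use P e eG finite_subset H in auto)
  define N where "N = {x \<in> H. x [^] (2 ^ n :: nat) \<in> P1}"
  have N: "subgroup N G" unfolding N_def by (rule subgroup_nat_pow_preimage[OF H(1) P1])
  have NH: "N \<subseteq> H" "finite N" using H by (auto simp: N_def)
  have P1N: "P1 \<subseteq> N" using P1H subgroup_nat_pow_closed[OF P1] by (auto simp: N_def)
  have BN: "B n \<subseteq> N" using PP1 by (auto simp: B_def N_def)
  have idx: "card H \<le> 2 * card N"
  proof (cases "2 * card (B n) < card H")
    case True
    \<comment> \<open>\<open>N\<close> properly contains the subgroup \<open>B n\<close> and so is
      at least twice as large, while \<open>H\<close> is at most four times as large as
      \<open>B n\<close>.\<close>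
    then obtain x where "x \<in> H - B n" "e = x [^] (2 ^ n :: nat)" using big by blast
    then have "x \<in> N - B n" using PP1 by (auto simp: N_def)
    then have "card (B n) < card N" using BN NH by (intro psubset_card_mono) auto
    moreover obtain k where k: "card N = card (B n) * k"
      using card_subgroup_dvd[OF N NH(2) Bs BN] by (auto simp: dvd_def)
    ultimately have "card (B n) * 1 < card (B n) * k" by simp
    then have "2 \<le> k" unfolding mult_less_cancel1 by simp
    then have "card (B n) * 2 \<le> card N" unfolding k by (rule mult_left_mono) simp
    then show ?thesis using last by simp
  next
    case False
    then show ?thesis using card_mono[OF NH(2) BN] by simp
  qed
  \<comment> \<open>\<open>N\<close> has index 1 or 2 in \<open>H\<close>. If it is all of
    \<open>H\<close>, any subgroup of index two containing \<open>P1\<close> will do; otherwise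
    \<open>N\<close> itself serves.\<close>
  have "\<exists>K. subgroup K G \<and> P1 \<subseteq> K \<and> K \<subseteq> N \<and> card H = 2 * card K"
  proof (cases "N = H")
    case True
    have "1 * card P \<le> 4 ^ n * card P" by (rule mult_right_mono) auto
    moreover have "card H = 4 * (4 ^ n * card P)" using card by simp
    ultimately have "card P1 < card H" using cP cP1 by linarith
    then have "P1 \<noteq> H" by auto
    moreover have "x [^] (2 ^ Suc n :: nat) \<in> P1" if "x \<in> H" for x using that pow PP1 by blast
    ultimately show ?thesis using index_two_subgroup[OF H P1 P1H, of "Suc n"] True by auto
  next
    case False
    then have "card N < card H" using NH H by (intro psubset_card_mono) auto
    moreover obtain k where k: "card H = card N * k"
      using card_subgroup_dvd[OF H N NH(1)] by (auto simp: dvd_def)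
    ultimately have "card N * 1 < card N * k" "card N * k \<le> card N * 2" using idx by auto
    then have "k = 2" unfolding mult_less_cancel1 mult_le_cancel1 by auto
    then show ?thesis using k N P1N by (intro exI[of _ N]) auto
  qed
  then obtain K where K: "subgroup K G" "P1 \<subseteq> K" "K \<subseteq> N" "card H = 2 * card K" by blast
  then show ?thesis using e NH unfolding P1_def N_def by (intro exI[of _ e] exI[of _ K]) auto
qed

section \<open>Gluing two perfect functions, and the induction\<close>

lemma sum_translate:
  fixes f :: "'a \<Rightarrow> int"
  assumes "subgroup H G" "a \<in> H"
  shows "(\<Sum>x\<in>H. f (x \<otimes> a)) = (\<Sum>x\<in>H. f x)"
proof -
  interpret H: subgroup H G by fact
  show ?thesis
    by (rule sum.reindex_bij_witness[of _ "\<lambda>x. x \<otimes> inv a" "\<lambda>x. x \<otimes> a"])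
      (use assms in \<open>auto simp: m_assoc\<close>)
qed

lemma sum_eq_zero_of_antiperiodic:
  fixes f :: "'a \<Rightarrow> int"
  assumes "subgroup H G" "a \<in> H" "\<And>x. x \<in> H \<Longrightarrow> f (x \<otimes> a) = - f x"
  shows "(\<Sum>x\<in>H. f x) = 0"
  using sum_translate[OF assms(1,2), of f] assms(3) by (simp add: sum_negf)

text \<open>\<open>f0\<close> is placed on \<open>K\<close> and \<open>f1\<close> on the other coset
  \<open>K #> t\<close>. A shift in \<open>K\<close> yields the sum of the two autocorrelations, a
  shift outside \<open>K\<close> two cross-correlations.\<close>

lemma perfect_function_glue:
  assumes H: "subgroup H G" "finite H" and K: "subgroup K G" "K \<subseteq> H" "card H = 2 * card K"
    and P1K: "P \<union> (P #> e) \<subseteq> K"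
    and e: "e \<in> H - P" "e \<otimes> e \<in> P" "\<psi> (e \<otimes> e) = 1" and \<psi>: "sign_character G P \<psi>"
    and f0: "perfect_function G K (P \<union> (P #> e)) (adjoin_sign G e 1 \<psi>) f0"
    and f1: "perfect_function G K (P \<union> (P #> e)) (adjoin_sign G e (-1) \<psi>) f1"
  shows "\<exists>f. perfect_function G H P \<psi> f"
proof -
  interpret H: subgroup H G by fact
  interpret K: subgroup K G by fact
  have P: "subgroup P G" using \<psi> by (simp add: sign_character_def)
  interpret P: subgroup P G by fact
  have eG: "e \<in> carrier G" using e by auto
  have eK: "e \<in> K" and PK: "P \<subseteq> K" using adjoin_mem[OF P eG] P1K by auto
  have mem: "p \<otimes> e \<in> P \<union> (P #> e)" if "p \<in> P" for p
    using that by (auto simp: r_coset_def)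
  have adj: "adjoin_sign G e s \<psi> p = \<psi> p" "adjoin_sign G e s \<psi> (p \<otimes> e) = s * \<psi> p"
    if "s \<in> {1, -1}" "p \<in> P" for s p
    using sign_character_adjoin(2,3)[OF \<psi> eG] e that by auto
  have f0P: "f0 (p \<otimes> x) = \<psi> p * f0 x" and f1P: "f1 (p \<otimes> x) = \<psi> p * f1 x"
    if "p \<in> P" "x \<in> K" for p x
    using f0 f1 that adj(1)[of 1 p] adj(1)[of "-1" p] by (auto simp: perfect_function_def)
  have f0Pe: "f0 ((p \<otimes> e) \<otimes> x) = \<psi> p * f0 x" and f1Pe: "f1 ((p \<otimes> e) \<otimes> x) = - \<psi> p * f1 x"
    if "p \<in> P" "x \<in> K" for p x
    using f0 f1 that mem[of p] adj(2)[of 1 p] adj(2)[of "-1" p] by (auto simp: perfect_function_def)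
  note \<psi>1 = sign_character_one[OF \<psi>]
  have f0e: "f0 (x \<otimes> e) = f0 x" and f1e: "f1 (x \<otimes> e) = - f1 x" if "x \<in> K" for x
    using f0Pe[of \<one> x] f1Pe[of \<one> x] that eG \<psi>1 m_comm[of x e] by auto
  have val: "f0 x \<in> {1, -1}" "f1 x \<in> {1, -1}" if "x \<in> K" for x
    using f0 f1 that by (auto simp: perfect_function_def)
  have cor0: "(\<Sum>x\<in>K. f0 x * f0 (x \<otimes> y)) = 0" and cor1: "(\<Sum>x\<in>K. f1 x * f1 (x \<otimes> y)) = 0"
    if "y \<in> K" "y \<notin> P \<union> (P #> e)" for y
    using f0 f1 that by (auto simp: perfect_function_def)
  have "card H \<noteq> 0" using H(2) H.one_closed by (metis card_0_eq empty_iff)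
  then have "K \<noteq> H" using K(3) by auto
  then obtain t where t: "t \<in> H" "t \<notin> K" using K(2) by blast
  have tG: "t \<in> carrier G" using t by auto
  have dis: "K \<inter> (K #> t) = {}" by (rule r_coset_disjoint[OF K(1) tG t(2)])
  have Kt: "K #> t \<subseteq> H" using K t by (auto simp: r_coset_def)
  have finK: "finite K" using K H finite_subset by auto
  then have fin: "finite (K #> t)" by (simp add: r_coset_def)
  have HK: "H = K \<union> (K #> t)"
  proof (rule card_subset_eq[symmetric])
    show "card (K \<union> (K #> t)) = card H" using K(3) card_adjoin[OF K(1) finK tG t(2)] by simp
  qed (use H K Kt in auto)
  have tinv: "(x \<otimes> t) \<otimes> inv t = x" if "x \<in> carrier G" for x using that tG by (simp add: m_assoc)
  have H_cases: "x \<in> K \<or> x \<notin> K \<and> (\<exists>k\<in>K. x = k \<otimes> t)" if "x \<in> H" for x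
    using that dis unfolding HK r_coset_def by blast
  have ktK: "k \<otimes> t \<notin> K" if "k \<in> K" for k using that dis unfolding r_coset_def by blast
  define f where "f = (\<lambda>x. if x \<in> K then f0 x else f1 (x \<otimes> inv t))"
  have fK: "f x = f0 x" if "x \<in> K" for x using that by (simp add: f_def)
  have fKt: "f (x \<otimes> t) = f1 x" if "x \<in> K" for x using that ktK tinv by (simp add: f_def)
  have split: "(\<Sum>x\<in>H. g x) = (\<Sum>x\<in>K. g x) + (\<Sum>x\<in>K. g (x \<otimes> t))" for g :: "'a \<Rightarrow> int"
  proof -
    have "(\<Sum>x\<in>H. g x) = (\<Sum>x\<in>K. g x) + (\<Sum>x\<in>K #> t. g x)"
      unfolding HK by (rule sum.union_disjoint[OF finK fin dis])
    moreover have "(\<Sum>x\<in>K #> t. g x) = (\<Sum>x\<in>K. g (x \<otimes> t))"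
      by (rule sum.reindex_bij_witness[of _ "\<lambda>x. x \<otimes> t" "\<lambda>x. x \<otimes> inv t"])
        (use tinv in \<open>auto simp: r_coset_def\<close>)
    ultimately show ?thesis by simp
  qed
  have "perfect_function G H P \<psi> f"
    unfolding perfect_function_def
  proof (intro conjI ballI)
    fix x assume "x \<in> H"
    then show "f x \<in> {1, -1}" using H_cases[of x] val fK fKt by metis
  next
    fix p x assume p: "p \<in> P" and x: "x \<in> H"
    from H_cases[OF x] show "f (p \<otimes> x) = \<psi> p * f x"
    proof
      assume "x \<in> K"
      then show ?thesis using p PK f0P fK by auto
    next
      assume "x \<notin> K \<and> (\<exists>k\<in>K. x = k \<otimes> t)"
      then obtain k where k: "k \<in> K" "x = k \<otimes> t" by blast
      have "p \<otimes> x = (p \<otimes> k) \<otimes> t" using k p tG by (simp add: m_assoc)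
      moreover have "p \<otimes> k \<in> K" using k p PK by auto
      ultimately show ?thesis using k p f1P fKt by simp
    qed
  next
    fix y assume y: "y \<in> H - P"
    then have yG: "y \<in> carrier G" by auto
    show "(\<Sum>x\<in>H. f x * f (x \<otimes> y)) = 0"
    proof (cases "y \<in> K")
      case True
      have *: "f (x \<otimes> t \<otimes> y) = f1 (x \<otimes> y)" if "x \<in> K" for x
      proof -
        have "x \<otimes> t \<otimes> y = (x \<otimes> y) \<otimes> t" using that tG yG by (simp add: m_ac)
        then show ?thesis using fKt that True by simp
      qed
      have "(\<Sum>x\<in>H. f x * f (x \<otimes> y)) = (\<Sum>x\<in>K. f0 x * f0 (x \<otimes> y)) + (\<Sum>x\<in>K. f1 x * f1 (x \<otimes> y))"
        unfolding split using True by (simp add: fK fKt *)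
      also have "\<dots> = 0"
      proof (cases "y \<in> P #> e")
        case True
        then obtain p where p: "p \<in> P" "y = p \<otimes> e" by (auto simp: r_coset_def)
        \<comment> \<open>On \<open>P #> e\<close> the terms of the two autocorrelations are
          constant and opposite, because the two extended characters differ in sign there.\<close>
        have "f0 x * f0 (x \<otimes> y) = \<psi> p" "f1 x * f1 (x \<otimes> y) = - \<psi> p" if x: "x \<in> K" for x
        proof -
          have c: "x \<otimes> y = (p \<otimes> e) \<otimes> x" using p x yG by (simp add: m_comm)
          have "f0 x * f0 x = 1" "f1 x * f1 x = 1" using val[OF x] by (auto intro: sign_square)
          then show "f0 x * f0 (x \<otimes> y) = \<psi> p" "f1 x * f1 (x \<otimes> y) = - \<psi> p"
            unfolding c f0Pe[OF p(1) x] f1Pe[OF p(1) x] by (simp_all add: mult.left_commute)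
        qed
        then show ?thesis by simp
      next
        case False
        then show ?thesis using cor0[of y] cor1[of y] y \<open>y \<in> K\<close> by simp
      qed
      finally show ?thesis .
    next
      case False
      then obtain k where k: "k \<in> K" "y = k \<otimes> t" using H_cases[of y] y by blast
      \<comment> \<open>Two elements outside a subgroup of index two have their product inside
        it.\<close>
      have tyK: "t \<otimes> y \<in> K"
      proof (rule ccontr)
        assume n: "t \<otimes> y \<notin> K"
        moreover have "t \<otimes> y \<in> H" using t y by simp
        ultimately obtain j where j: "j \<in> K" "t \<otimes> y = j \<otimes> t" using H_cases[of "t \<otimes> y"] by blast
        then have "y \<otimes> t = j \<otimes> t" using tG yG by (simp add: m_comm)
        then have "y = j" using tG yG j(1) by simp
        then show False using j(1) False by simp
      qed
      have 1: "f (x \<otimes> y) = f1 (x \<otimes> k)" if "x \<in> K" for x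
        using fKt[of "x \<otimes> k"] that k tG by (simp add: m_assoc)
      have 2: "f (x \<otimes> t \<otimes> y) = f0 (x \<otimes> (t \<otimes> y))" if "x \<in> K" for x
        using fK[of "x \<otimes> (t \<otimes> y)"] that tyK tG yG by (simp add: m_assoc)
      have sw: "x \<otimes> e \<otimes> z = x \<otimes> z \<otimes> e" if "x \<in> K" "z \<in> K" for x z
        using that eG by (simp add: m_ac)
      have "(\<Sum>x\<in>H. f x * f (x \<otimes> y)) =
          (\<Sum>x\<in>K. f0 x * f1 (x \<otimes> k)) + (\<Sum>x\<in>K. f1 x * f0 (x \<otimes> (t \<otimes> y)))"
        unfolding split by (simp add: fK fKt 1 2)
      \<comment> \<open>Translating \<open>x\<close> by \<open>e\<close> fixes \<open>f0\<close> and
        negates \<open>f1\<close>, so each cross-correlation equals its own negative.\<close>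
      also have "(\<Sum>x\<in>K. f0 x * f1 (x \<otimes> k)) = 0"
        by (rule sum_eq_zero_of_antiperiodic[OF K(1) eK]) (simp add: f0e f1e sw k)
      also have "(\<Sum>x\<in>K. f1 x * f0 (x \<otimes> (t \<otimes> y))) = 0"
        by (rule sum_eq_zero_of_antiperiodic[OF K(1) eK]) (simp add: f0e f1e sw tyK)
      finally show ?thesis by simp
    qed
  qed
  then show ?thesis by blast
qed

theorem exists_perfect_function:
  assumes "subgroup H G" "finite H" "P \<subseteq> H" "sign_character G P \<psi>"
    and "card H = 4 ^ n * card P" "\<And>x. x \<in> H \<Longrightarrow> x [^] (2 ^ n :: nat) \<in> P"
  shows "\<exists>f. perfect_function G H P \<psi> f"
  using assms
proof (induction n arbitrary: H P \<psi>)
  case 0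
  \<comment> \<open>With index 1, \<open>\<psi>\<close> is its own perfect function, the
    autocorrelation condition being vacuous.\<close>
  then have "P = H" using card_subset_eq[of H P] by simp
  then have "perfect_function G H P \<psi> \<psi>"
    using 0 by (auto simp: perfect_function_def sign_character_def)
  then show ?case by blast
next
  case (Suc n)
  have P: "subgroup P G" using Suc.prems by (simp add: sign_character_def)
  obtain e K where e: "e \<in> H - P" "e \<otimes> e \<in> P" "\<psi> (e \<otimes> e) = 1"
    and K: "subgroup K G" "P \<union> (P #> e) \<subseteq> K" "K \<subseteq> H" "card H = 2 * card K"
      "\<And>x. x \<in> K \<Longrightarrow> x [^] (2 ^ n :: nat) \<in> P \<union> (P #> e)"
    using exists_descent_step[OF Suc.prems(1,2) P Suc.prems(3,5,6,4)] by blast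
  have eG: "e \<in> carrier G" using e subgroup.mem_carrier[OF Suc.prems(1)] by auto
  have fin: "finite K" "finite P" using K Suc.prems finite_subset by auto
  have "card (P \<union> (P #> e)) = 2 * card P" using card_adjoin[OF P fin(2) eG] e by simp
  \<comment> \<open>Passing to \<open>K\<close> halves the group and adjoining \<open>e\<close>
    doubles \<open>P\<close>, so the index drops by exactly the factor 4 that one induction step
    allows.\<close>
  then have card: "card K = 4 ^ n * card (P \<union> (P #> e))" using K(4) Suc.prems(5) by (simp add: mult_ac)
  have "\<exists>f. perfect_function G K (P \<union> (P #> e)) (adjoin_sign G e s \<psi>) f" if "s \<in> {1, -1}" for s
    using sign_character_adjoin(1)[OF Suc.prems(4) eG _ e(2,3) that] e
    by (intro Suc.IH[OF K(1) fin(1) K(2) _ card K(5)]) auto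
  from this[of 1] this[of "-1"] show ?case
    using perfect_function_glue[OF Suc.prems(1,2) K(1,3,4,2) e Suc.prems(4)] by auto
qed

end

subsection \<open>The group ring and the elements chi\<close>

lemma group_ring_simps:
  "carrier (group_ring G) = {A. finite {g. A g \<noteq> 0} \<and> {g. A g \<noteq> 0} \<subseteq> carrier G}"
  "\<one>\<^bsub>group_ring G\<^esub> = (\<lambda>g. of_bool (g = \<one>\<^bsub>G\<^esub>))"
  by (simp_all add: group_ring_def)

context comm_group
begin

lemma group_ring_carrier_iff:
  assumes "finite (carrier G)"
  shows "A \<in> carrier (group_ring G) \<longleftrightarrow> (\<forall>g. g \<notin> carrier G \<longrightarrow> A g = 0)"
  using assms by (auto simp: group_ring_simps intro: finite_subset)

lemma sum_carrier_translate:
  fixes f :: "'a \<Rightarrow> int"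
  assumes "a \<in> carrier G"
  shows "(\<Sum>x\<in>carrier G. f (a \<otimes> x)) = (\<Sum>x\<in>carrier G. f x)"
  by (rule sum.reindex_bij_witness[of _ "\<lambda>x. inv a \<otimes> x" "\<lambda>x. a \<otimes> x"])
    (use assms in \<open>auto simp: m_assoc[symmetric]\<close>)

text \<open>In the defining sum over pairs, \<open>k\<close> is determined by \<open>h\<close> and
  \<open>g\<close>; what remains is a convolution over the finite carrier.\<close>

lemma group_ring_mult_apply:
  assumes fin: "finite (carrier G)"
    and A: "A \<in> carrier (group_ring G)" and B: "B \<in> carrier (group_ring G)"
  shows "(A \<otimes>\<^bsub>group_ring G\<^esub> B) g =
    (if g \<in> carrier G then \<Sum>h\<in>carrier G. A h * B (inv h \<otimes> g) else 0)"
proof -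
  let ?S = "{(h, k). A h \<noteq> 0 \<and> B k \<noteq> 0 \<and> h \<otimes> k = g}"
  have A0: "h \<in> carrier G" if "A h \<noteq> 0" for h using A that by (auto simp: group_ring_simps)
  have B0: "h \<in> carrier G" if "B h \<noteq> 0" for h using B that by (auto simp: group_ring_simps)
  have *: "(A \<otimes>\<^bsub>group_ring G\<^esub> B) g = (\<Sum>(h, k)\<in>?S. A h * B k)"
    by (simp add: group_ring_def)
  show ?thesis
  proof (cases "g \<in> carrier G")
    case False
    then have "?S = {}" using A0 B0 by auto
    show ?thesis unfolding * \<open>?S = {}\<close> using False by simp
  next
    case True
    let ?H = "{h \<in> carrier G. A h * B (inv h \<otimes> g) \<noteq> 0}"
    have "(\<Sum>(h, k)\<in>?S. A h * B k) = (\<Sum>h\<in>?H. A h * B (inv h \<otimes> g))"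
    proof (rule sum.reindex_bij_witness[of _ "\<lambda>h. (h, inv h \<otimes> g)" fst])
      fix a assume "a \<in> ?S"
      then obtain h k where a: "a = (h, k)" "A h \<noteq> 0" "B k \<noteq> 0" "h \<otimes> k = g" by auto
      then have hk: "h \<in> carrier G" "k \<in> carrier G" "k = inv h \<otimes> g"
        using A0 B0 by (auto simp: m_assoc[symmetric])
      show "(fst a, inv fst a \<otimes> g) = a" "fst a \<in> ?H"
        "A (fst a) * B (inv fst a \<otimes> g) = (case a of (h, k) \<Rightarrow> A h * B k)"
        using a hk by auto
    next
      fix h assume "h \<in> ?H"
      then show "(h, inv h \<otimes> g) \<in> ?S" using True by (auto simp: m_assoc[symmetric])
    qed simp
    also have "\<dots> = (\<Sum>h\<in>carrier G. A h * B (inv h \<otimes> g))"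
      by (rule sum.mono_neutral_left) (use fin in auto)
    finally show ?thesis unfolding * using True by simp
  qed
qed

text \<open>This makes the \<open>finprod\<close> rules available for the product that defines
  \<open>chi\<close>.\<close>

lemma comm_monoid_group_ring:
  assumes fin: "finite (carrier G)"
  shows "comm_monoid (group_ring G)"
proof (rule comm_monoidI)
  have closed: "A \<otimes>\<^bsub>group_ring G\<^esub> B \<in> carrier (group_ring G)"
    if "A \<in> carrier (group_ring G)" "B \<in> carrier (group_ring G)" for A B
    using that by (simp add: group_ring_carrier_iff[OF fin] group_ring_mult_apply[OF fin])
  show "A \<otimes>\<^bsub>group_ring G\<^esub> B \<in> carrier (group_ring G)"
    if "A \<in> carrier (group_ring G)" "B \<in> carrier (group_ring G)" for A B
    using that by (rule closed)
  show one: "\<one>\<^bsub>group_ring G\<^esub> \<in> carrier (group_ring G)"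
    by (auto simp: group_ring_carrier_iff[OF fin] group_ring_simps(2))
  fix A B C
  assume A: "A \<in> carrier (group_ring G)" and B: "B \<in> carrier (group_ring G)"
  show "\<one>\<^bsub>group_ring G\<^esub> \<otimes>\<^bsub>group_ring G\<^esub> A = A"
  proof
    fix g
    have "(\<Sum>h\<in>carrier G. of_bool (h = \<one>) * A (inv h \<otimes> g)) = A g" if "g \<in> carrier G"
      using that fin by (simp add: of_bool_def if_distrib[of "\<lambda>x. x * _"] cong: if_cong)
    then show "(\<one>\<^bsub>group_ring G\<^esub> \<otimes>\<^bsub>group_ring G\<^esub> A) g = A g"
      using A unfolding group_ring_mult_apply[OF fin one A]
      by (simp add: group_ring_simps(2) group_ring_carrier_iff[OF fin])
  qed
  show "A \<otimes>\<^bsub>group_ring G\<^esub> B = B \<otimes>\<^bsub>group_ring G\<^esub> A"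
  proof
    fix g
    have "(\<Sum>h\<in>carrier G. A h * B (inv h \<otimes> g)) = (\<Sum>h\<in>carrier G. B h * A (inv h \<otimes> g))"
      if g: "g \<in> carrier G"
    proof (rule sum.reindex_bij_witness[of _ "\<lambda>h. inv h \<otimes> g" "\<lambda>h. inv h \<otimes> g"])
      fix a assume a: "a \<in> carrier G"
      show "inv (inv a \<otimes> g) \<otimes> g = a" using a g by (simp add: inv_mult m_assoc)
      then show "B (inv a \<otimes> g) * A (inv (inv a \<otimes> g) \<otimes> g) = A a * B (inv a \<otimes> g)"
        by (simp add: mult.commute)
    qed (use g in \<open>auto simp: inv_mult m_assoc\<close>)
    then show "(A \<otimes>\<^bsub>group_ring G\<^esub> B) g = (B \<otimes>\<^bsub>group_ring G\<^esub> A) g"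
      by (simp add: group_ring_mult_apply[OF fin] A B)
  qed
  assume C: "C \<in> carrier (group_ring G)"
  show "A \<otimes>\<^bsub>group_ring G\<^esub> B \<otimes>\<^bsub>group_ring G\<^esub> C = A \<otimes>\<^bsub>group_ring G\<^esub> (B \<otimes>\<^bsub>group_ring G\<^esub> C)"
  proof
    fix g
    have "(\<Sum>h\<in>carrier G. (\<Sum>j\<in>carrier G. A j * B (inv j \<otimes> h)) * C (inv h \<otimes> g)) =
        (\<Sum>j\<in>carrier G. A j * (\<Sum>h\<in>carrier G. B h * C (inv h \<otimes> (inv j \<otimes> g))))"
      if g: "g \<in> carrier G"
    proof -
      \<comment> \<open>For associativity the two sums are interchanged, and then \<open>h\<close>
        is shifted by \<open>j\<close>.\<close>
      have "(\<Sum>h\<in>carrier G. (\<Sum>j\<in>carrier G. A j * B (inv j \<otimes> h)) * C (inv h \<otimes> g)) =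
          (\<Sum>j\<in>carrier G. A j * (\<Sum>h\<in>carrier G. B (inv j \<otimes> h) * C (inv h \<otimes> g)))"
        unfolding sum_distrib_right sum_distrib_left
        by (subst sum.swap) (simp add: mult.assoc)
      also have "\<dots> = (\<Sum>j\<in>carrier G. A j * (\<Sum>h\<in>carrier G. B h * C (inv h \<otimes> (inv j \<otimes> g))))"
      proof (rule sum.cong[OF refl])
        fix j assume j: "j \<in> carrier G"
        have "(\<Sum>h\<in>carrier G. B (inv j \<otimes> h) * C (inv h \<otimes> g)) =
            (\<Sum>h\<in>carrier G. B (inv j \<otimes> (j \<otimes> h)) * C (inv (j \<otimes> h) \<otimes> g))"
          by (rule sum_carrier_translate[OF j, symmetric])
        also have "\<dots> = (\<Sum>h\<in>carrier G. B h * C (inv h \<otimes> (inv j \<otimes> g)))"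
          by (rule sum.cong[OF refl]) (use j g in \<open>simp add: inv_mult_group m_assoc[symmetric]\<close>)
        finally show "A j * (\<Sum>h\<in>carrier G. B (inv j \<otimes> h) * C (inv h \<otimes> g)) =
            A j * (\<Sum>h\<in>carrier G. B h * C (inv h \<otimes> (inv j \<otimes> g)))" by simp
      qed
      finally show ?thesis .
    qed
    then show "(A \<otimes>\<^bsub>group_ring G\<^esub> B \<otimes>\<^bsub>group_ring G\<^esub> C) g =
        (A \<otimes>\<^bsub>group_ring G\<^esub> (B \<otimes>\<^bsub>group_ring G\<^esub> C)) g"
      by (simp add: group_ring_mult_apply[OF fin] closed A B C cong: sum.cong)
  qed
qed

section \<open>The element \<open>chi\<close> as a sign character\<close>

lemma generate_insert:
  assumes "S \<subseteq> carrier G" "e \<in> carrier G" "e \<otimes> e \<in> generate G S"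
  shows "generate G (insert e S) = generate G S \<union> (generate G S #> e)"
proof
  have W: "subgroup (generate G S) G" by (rule generate_is_subgroup[OF assms(1)])
  show "generate G (insert e S) \<subseteq> generate G S \<union> (generate G S #> e)"
    using adjoin_mem[OF W assms(2)] generate.incl[of _ S G]
    by (intro generate_subgroup_incl subgroup_adjoin[OF W assms(2,3)]) auto
  show "generate G S \<union> (generate G S #> e) \<subseteq> generate G (insert e S)"
  proof (rule adjoin_subset)
    show "subgroup (generate G (insert e S)) G" using assms by (intro generate_is_subgroup) auto
    show "generate G S \<subseteq> generate G (insert e S)" by (rule mono_generate) auto
    show "e \<in> generate G (insert e S)" by (rule generate.incl) simp
  qed
qed

text \<open>Multiplying by one factor is \<open>adjoin_sign\<close>, so the product grows out of the
  trivial character by adjoining one generator at a time. Independence keeps each \<open>x i\<close>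
  outside the subgroup reached so far, and its square is \<open>\<one>\<close>, where every sign
  character is 1.\<close>

lemma sign_character_finprod:
  assumes fin: "finite (carrier G)" and sq: "\<And>g. g \<in> carrier G \<Longrightarrow> g \<otimes> g = \<one>"
    and "finite I" "x ` I \<subseteq> carrier G" "\<And>i. i \<in> I \<Longrightarrow> x i \<notin> generate G (x ` (I - {i}))"
    and s: "\<And>i. s i \<in> {1, -1}"
  shows "sign_character G (generate G (x ` I))
    (finprod (group_ring G) (\<lambda>i g. of_bool (g = \<one>) + s i * of_bool (g = x i)) I)"
  using assms(3-5)
proof (induction I rule: finite_induct)
  case empty
  interpret R: comm_monoid "group_ring G" by (rule comm_monoid_group_ring[OF fin])
  have "subgroup {\<one>} G" by (rule triv_subgroup)
  then show ?case by (auto simp: generate_empty sign_character_def group_ring_simps(2))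
next
  case (insert i I)
  interpret R: comm_monoid "group_ring G" by (rule comm_monoid_group_ring[OF fin])
  let ?f = "\<lambda>i g. of_bool (g = \<one>) + s i * of_bool (g = x i)"
  have x: "x ` I \<subseteq> carrier G" "x i \<in> carrier G" using insert.prems by auto
  have f: "?f j \<in> carrier (group_ring G)" if "x j \<in> carrier G" for j
    using that by (auto simp: group_ring_carrier_iff[OF fin])
  let ?F = "finprod (group_ring G) ?f I"
  have "x j \<notin> generate G (x ` (I - {j}))" if "j \<in> I" for j
    using insert.prems(2)[of j] that mono_generate[of "x ` (I - {j})" "x ` (insert i I - {j})"] by blast
  then have IH: "sign_character G (generate G (x ` I)) ?F" using insert.IH x by blast
  have F: "?F \<in> carrier (group_ring G)" using x by (intro R.finprod_closed) (auto intro!: f)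
  have nin: "x i \<notin> generate G (x ` I)" using insert.prems(2)[of i] insert.hyps by simp
  have one: "\<one> \<in> generate G (x ` I)" by (rule generate.one)
  then have sqi: "x i \<otimes> x i \<in> generate G (x ` I)" using sq x by simp
  have F1: "?F (x i \<otimes> x i) = 1" using sq x sign_character_one[OF IH] by simp
  have "finprod (group_ring G) ?f (insert i I) = ?f i \<otimes>\<^bsub>group_ring G\<^esub> ?F"
    using insert.hyps x by (intro R.finprod_insert) (auto intro!: f)
  also have "\<dots> = adjoin_sign G (x i) (s i) ?F"
  proof
    fix g
    have "(\<Sum>h\<in>carrier G. ?f i h * ?F (inv h \<otimes> g)) = ?F g + s i * ?F (inv x i \<otimes> g)"
      if g: "g \<in> carrier G"
    proof -
      have "(\<Sum>h\<in>carrier G. ?f i h * ?F (inv h \<otimes> g)) =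
          (\<Sum>h\<in>carrier G. if h = \<one> then ?F (inv h \<otimes> g) else 0) +
          (\<Sum>h\<in>carrier G. if h = x i then s i * ?F (inv h \<otimes> g) else 0)"
        unfolding sum.distrib[symmetric] by (rule sum.cong) (auto simp: algebra_simps)
      then show ?thesis using fin x g by simp
    qed
    then show "(?f i \<otimes>\<^bsub>group_ring G\<^esub> ?F) g = adjoin_sign G (x i) (s i) ?F g"
      using group_ring_mult_apply[OF fin f[OF x(2)] F, of g] by (simp add: adjoin_sign_def)
  qed
  finally show ?case
    using sign_character_adjoin(1)[OF IH x(2) nin sqi F1 s] generate_insert[OF x sqi] by simp
qed

subsection \<open>Rank and elementary abelian subgroups\<close>

text \<open>Since all squares lie in \<open>Q\<close>, adjoining the elements of \<open>S\<close>
  one at a time at most doubles the subgroup at each step.\<close>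

lemma exists_subgroup_containing:
  assumes fin: "finite (carrier G)" and Q: "subgroup Q G" "\<And>x. x \<in> carrier G \<Longrightarrow> x \<otimes> x \<in> Q"
    and "finite S" "S \<subseteq> carrier G"
  shows "\<exists>W. subgroup W G \<and> Q \<subseteq> W \<and> S \<subseteq> W \<and> card W \<le> 2 ^ card S * card Q"
  using assms(4,5)
proof (induction S rule: finite_induct)
  case empty
  then show ?case using Q by auto
next
  case (insert e S)
  then obtain W where W: "subgroup W G" "Q \<subseteq> W" "S \<subseteq> W" "card W \<le> 2 ^ card S * card Q" by auto
  have e: "e \<in> carrier G" using insert by simp
  let ?V = "W \<union> (W #> e)"
  have "subgroup ?V G" by (rule subgroup_adjoin) (use W Q e in auto)
  moreover have "insert e S \<subseteq> ?V" using adjoin_mem[OF W(1) e] W by auto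
  moreover have "card ?V \<le> 2 ^ card (insert e S) * card Q"
    using card_Un_le[of W "W #> e"] card_r_coset[OF subgroup.subset[OF W(1)] e] W(4) insert.hyps
    by simp
  ultimately show ?case using W(2) by blast
qed

lemma card_le_generating_set:
  assumes "finite (carrier G)" "subgroup Q G" "\<And>x. x \<in> carrier G \<Longrightarrow> x \<otimes> x \<in> Q"
    and "finite S" "S \<subseteq> carrier G" "generate G S = carrier G"
  shows "card (carrier G) \<le> 2 ^ card S * card Q"
proof -
  obtain W where W: "subgroup W G" "S \<subseteq> W" "card W \<le> 2 ^ card S * card Q"
    using exists_subgroup_containing[OF assms(1-5)] by blast
  have "carrier G \<subseteq> W" using generate_subgroup_incl[OF W(2,1)] assms(6) by simp
  then show ?thesis using W subgroup.subset[OF W(1)] by (metis subset_antisym)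
qed

text \<open>The \<open>x i\<close> lift a basis of G/Q, a vector space over GF(2). \<open>Q\<close>
  is enlarged by one outside element at a time until it fills the group; each enlargement doubles it
  exactly, whence the exact power of two.\<close>

lemma exists_independent_generators:
  assumes fin: "finite (carrier G)" and "subgroup Q G" "\<And>x. x \<in> carrier G \<Longrightarrow> x \<otimes> x \<in> Q"
  shows "\<exists>n (x :: nat \<Rightarrow> 'a). x ` {1..n} \<subseteq> carrier G \<and> card (carrier G) = 2 ^ n * card Q \<and>
    (\<forall>g\<in>carrier G. \<exists>h\<in>generate G (x ` {1..n}). \<exists>q\<in>Q. g = h \<otimes> q)"
  using assms(2,3)
proof (induction "card (carrier G) - card Q" arbitrary: Q rule: less_induct)
  case less
  interpret Q: subgroup Q G by fact
  show ?case
  proof (cases "Q = carrier G")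
    case True
    then show ?thesis
      by (intro exI[of _ 0] exI[of _ "\<lambda>_. \<one>"]) (auto simp: generate_empty)
  next
    case False
    then obtain e where e: "e \<in> carrier G" "e \<notin> Q" using Q.subset by auto
    let ?Q = "Q \<union> (Q #> e)"
    have finQ: "finite Q" using fin Q.subset finite_subset by auto
    have sub: "subgroup ?Q G" by (rule subgroup_adjoin) (use less.prems e in auto)
    have c: "card ?Q = 2 * card Q" by (rule card_adjoin) (use less.prems finQ e in auto)
    have "card Q > 0" using finQ Q.one_closed by (metis card_gt_0_iff empty_iff)
    moreover have "card ?Q \<le> card (carrier G)" by (rule card_mono[OF fin subgroup.subset[OF sub]])
    ultimately have "card (carrier G) - card ?Q < card (carrier G) - card Q" using c by linarith
    from less.hyps[OF this sub] less.prems(2) obtain n x where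
      x: "x ` {1..n} \<subseteq> carrier G" and n: "card (carrier G) = 2 ^ n * card ?Q"
      and gen: "\<And>g. g \<in> carrier G \<Longrightarrow> \<exists>h\<in>generate G (x ` {1..n}). \<exists>q\<in>?Q. g = h \<otimes> q" by auto
    let ?x = "x(Suc n := e)"
    have im: "?x ` {1..Suc n} = insert e (x ` {1..n})"
      by (auto simp: atLeastAtMostSuc_conv)
    have sub': "subgroup (generate G (insert e (x ` {1..n}))) G"
      using e x by (intro generate_is_subgroup) auto
    interpret V: subgroup "generate G (insert e (x ` {1..n}))" G by fact
    have "\<exists>h\<in>generate G (insert e (x ` {1..n})). \<exists>q\<in>Q. g = h \<otimes> q" if "g \<in> carrier G" for g
    proof -
      obtain h q where hq: "h \<in> generate G (x ` {1..n})" "q \<in> ?Q" "g = h \<otimes> q" using gen[OF \<open>g \<in> carrier G\<close>] by blast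
      have h: "h \<in> generate G (insert e (x ` {1..n}))"
        using hq(1) mono_generate[of "x ` {1..n}" "insert e (x ` {1..n})"] by auto
      have eV: "e \<in> generate G (insert e (x ` {1..n}))" by (rule generate.incl) simp
      from hq(2) show ?thesis
      proof
        assume "q \<in> Q #> e"
        then obtain p where p: "p \<in> Q" "q = p \<otimes> e" by (auto simp: r_coset_def)
        \<comment> \<open>The factor \<open>e\<close> moves to the generated part, leaving a factor
          in the original \<open>Q\<close>.\<close>
        have "g = (h \<otimes> e) \<otimes> p" using hq(3) p e V.mem_carrier[OF h] by (simp add: m_ac)
        then show ?thesis using V.m_closed[OF h eV] p by blast
      qed (use h hq in blast)
    qed
    then show ?thesis using x e n c unfolding im[symmetric]
      by (intro exI[of _ "Suc n"] exI[of _ ?x]) (auto simp: im)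
  qed
qed

text \<open>This is the Burnside basis argument: decomposing \<open>y\<close> again and again writes
  each element as a generated one times a 2^k-th power for every \<open>k\<close>, and at k = n the
  power is trivial.\<close>

lemma generate_eq_carrier_of_mod_squares:
  assumes S: "S \<subseteq> carrier G" and exp: "\<And>x. x \<in> carrier G \<Longrightarrow> x [^] (2 ^ n :: nat) = \<one>"
    and gen: "\<And>g. g \<in> carrier G \<Longrightarrow> \<exists>h\<in>generate G S. \<exists>y\<in>carrier G. g = h \<otimes> (y \<otimes> y)"
  shows "generate G S = carrier G"
proof -
  interpret W: subgroup "generate G S" G by (rule generate_is_subgroup[OF S])
  have "\<exists>h\<in>generate G S. \<exists>y\<in>carrier G. g = h \<otimes> y [^] (2 ^ k :: nat)" if "g \<in> carrier G" for g k
  proof (induction k)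
    case 0
    show ?case using that W.one_closed by (intro bexI[of _ \<one>] bexI[of _ g]) auto
  next
    case (Suc k)
    then obtain h y where h: "h \<in> generate G S" "y \<in> carrier G" "g = h \<otimes> y [^] (2 ^ k :: nat)" by blast
    obtain j z where j: "j \<in> generate G S" "z \<in> carrier G" "y = j \<otimes> (z \<otimes> z)" using gen[OF h(2)] by blast
    have "y [^] (2 ^ k :: nat) = j [^] (2 ^ k :: nat) \<otimes> z [^] (2 ^ Suc k :: nat)"
      using j by (simp add: pow_mult_distrib m_comm nat_pow_mult mult_2)
    then have "g = (h \<otimes> j [^] (2 ^ k :: nat)) \<otimes> z [^] (2 ^ Suc k :: nat)"
      using h j by (simp add: m_assoc)
    moreover have "h \<otimes> j [^] (2 ^ k :: nat) \<in> generate G S"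
      using h j subgroup_nat_pow_closed[OF W.subgroup_axioms] by auto
    ultimately show ?case using j by blast
  qed
  from this[of _ n] have "carrier G \<subseteq> generate G S" using exp by fastforce
  then show ?thesis using W.subset by blast
qed

text \<open>A redundant generator could be dropped, and fewer than \<open>card I\<close> involutions
  generate too small a group.\<close>

lemma independent_of_card_generate:
  assumes fin: "finite (carrier G)" and sq: "\<And>g. g \<in> carrier G \<Longrightarrow> g \<otimes> g = \<one>"
    and I: "finite I" "x ` I \<subseteq> carrier G" "generate G (x ` I) = carrier G"
    and card: "card (carrier G) = 2 ^ card I" and i: "i \<in> I"
  shows "x i \<notin> generate G (x ` (I - {i}))"
proof
  let ?S = "x ` (I - {i})"
  assume xi: "x i \<in> generate G ?S"
  have S: "?S \<subseteq> carrier G" using I by auto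
  have "x ` I \<subseteq> generate G ?S" using xi generate.incl[of _ ?S G] by blast
  then have "generate G ?S = carrier G"
    using generate_subgroup_incl[OF _ generate_is_subgroup[OF S]] I(3) generate_incl[OF S] by blast
  then have "card (carrier G) \<le> 2 ^ card ?S * card {\<one>}"
    using sq I S by (intro card_le_generating_set fin triv_subgroup) auto
  also have "\<dots> \<le> 2 ^ (card I - 1)"
    using card_image_le[of "I - {i}" x] I i by simp
  also have "\<dots> < 2 ^ card I"
  proof (rule power_strict_increasing)
    have "0 < card I" using I(1) i by (metis card_gt_0_iff empty_iff)
    then show "card I - 1 < card I" by simp
  qed simp
  finally show False using card by simp
qed

text \<open>The map \<open>\<phi>\<close> raises the generators to the given exponents. It is a
  homomorphism because squares are trivial, surjective because unit vectors hit the generators, and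
  then injective by counting.\<close>

lemma C2_power_iso:
  fixes x :: "nat \<Rightarrow> 'a"
  assumes fin: "finite (carrier G)" and sq: "\<And>g. g \<in> carrier G \<Longrightarrow> g \<otimes> g = \<one>"
    and x: "x ` {1..n} \<subseteq> carrier G" "generate G (x ` {1..n}) = carrier G"
    and card: "card (carrier G) = 2 ^ n"
  shows "C2_power n \<cong> G"
proof -
  define \<phi> where "\<phi> v = (\<Otimes>i\<in>{1..n}. x i [^] nat (v i))" for v :: "nat \<Rightarrow> int"
  have C: "carrier (C2_power n) = {1..n} \<rightarrow>\<^sub>E {0..<2}"
    by (simp add: C2_power_def carrier_integer_mod_group)
  have grp: "group (C2_power n)" by (simp add: C2_power_def)
  have xc: "x i \<in> carrier G" if "i \<in> {1..n}" for i using x that by blast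
  have pow: "y [^] nat ((a + b) mod 2) = y [^] nat a \<otimes> y [^] nat b"
    if "y \<in> carrier G" "a \<in> {0..<2}" "b \<in> {0..<2}" for y and a b :: int
  proof -
    have "a = 0 \<or> a = 1" "b = 0 \<or> b = 1" using that by auto
    then show ?thesis using that(1) sq by auto
  qed
  have hom: "\<phi> \<in> hom (C2_power n) G"
  proof (rule homI)
    fix v w assume "v \<in> carrier (C2_power n)" "w \<in> carrier (C2_power n)"
    then have vw: "v i \<in> {0..<2}" "w i \<in> {0..<2}" if "i \<in> {1..n}" for i
      using that unfolding C by (auto dest: PiE_mem)
    have "\<phi> (v \<otimes>\<^bsub>C2_power n\<^esub> w) = (\<Otimes>i\<in>{1..n}. x i [^] nat (v i) \<otimes> x i [^] nat (w i))"
      unfolding \<phi>_def by (rule finprod_cong') (use pow vw xc in \<open>auto simp: C2_power_def\<close>)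
    also have "\<dots> = \<phi> v \<otimes> \<phi> w"
      unfolding \<phi>_def by (rule finprod_multf) (use xc in auto)
    finally show "\<phi> (v \<otimes>\<^bsub>C2_power n\<^esub> w) = \<phi> v \<otimes> \<phi> w" .
  qed (use xc in \<open>auto simp: \<phi>_def intro!: finprod_closed\<close>)
  interpret \<phi>: group_hom "C2_power n" G \<phi>
    using grp hom by (simp add: group_hom_def group_hom_axioms_def)
  have "x j \<in> \<phi> ` carrier (C2_power n)" if j: "j \<in> {1..n}" for j
  proof -
    let ?v = "\<lambda>i\<in>{1..n}. if j = i then 1 else 0"
    have "\<phi> ?v = (\<Otimes>i\<in>{1..n}. if j = i then x i else \<one>)"
      unfolding \<phi>_def by (rule finprod_cong') (use xc in auto)
    also have "\<dots> = x j" using j xc by (intro finprod_singleton) auto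
    finally have "x j = \<phi> ?v" ..
    moreover have "?v \<in> carrier (C2_power n)" unfolding C by auto
    ultimately show ?thesis by (rule image_eqI)
  qed
  then have "x ` {1..n} \<subseteq> \<phi> ` carrier (C2_power n)" by blast
  then have "carrier G \<subseteq> \<phi> ` carrier (C2_power n)"
    using generate_subgroup_incl[OF _ \<phi>.img_is_subgroup] x(2) by metis
  moreover have "\<phi> ` carrier (C2_power n) \<subseteq> carrier G" using hom by (auto simp: hom_def)
  ultimately have surj: "\<phi> ` carrier (C2_power n) = carrier G" by blast
  have "card (carrier (C2_power n)) = 2 ^ n" unfolding C by (simp add: card_PiE)
  moreover have "finite (carrier (C2_power n))" unfolding C by (simp add: finite_PiE)
  ultimately have "inj_on \<phi> (carrier (C2_power n))"
    using surj card by (intro eq_card_imp_inj_on) auto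
  then show ?thesis using hom surj by (intro is_isoI isoI) (auto simp: bij_betw_def)
qed

lemma subgroup_involutions: "subgroup {x \<in> carrier G. x \<otimes> x = \<one>} G"
proof (rule subgroupI)
  fix a b assume "a \<in> {x \<in> carrier G. x \<otimes> x = \<one>}" "b \<in> {x \<in> carrier G. x \<otimes> x = \<one>}"
  then have ab: "a \<in> carrier G" "b \<in> carrier G" "a \<otimes> a = \<one>" "b \<otimes> b = \<one>" by auto
  then have "(a \<otimes> b) \<otimes> (a \<otimes> b) = (a \<otimes> a) \<otimes> (b \<otimes> b)" by (metis m_assoc m_comm m_closed)
  then show "a \<otimes> b \<in> {x \<in> carrier G. x \<otimes> x = \<one>}" using ab by simp
qed (auto simp flip: inv_mult_group)

lemma subgroup_squares: "subgroup ((\<lambda>x. x \<otimes> x) ` carrier G) G"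
proof (rule subgroupI)
  fix a b assume "a \<in> (\<lambda>x. x \<otimes> x) ` carrier G" "b \<in> (\<lambda>x. x \<otimes> x) ` carrier G"
  then obtain x y where xy: "x \<in> carrier G" "y \<in> carrier G" "a = x \<otimes> x" "b = y \<otimes> y" by auto
  then have "a \<otimes> b = (x \<otimes> y) \<otimes> (x \<otimes> y)" by (simp add: m_ac)
  then show "a \<otimes> b \<in> (\<lambda>x. x \<otimes> x) ` carrier G" using xy by blast
next
  fix a assume "a \<in> (\<lambda>x. x \<otimes> x) ` carrier G"
  then obtain x where "x \<in> carrier G" "a = x \<otimes> x" by auto
  then show "inv a \<in> (\<lambda>x. x \<otimes> x) ` carrier G"
    by (intro image_eqI[of _ _ "inv x"]) (auto simp: inv_mult)
qed auto

text \<open>Squaring has kernel \<open>?E\<close> and image \<open>?Q\<close>, so \<open>?E\<close>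
  has the order of G/Q. That order is 2 to the rank: a generating set also generates G/Q, which
  bounds the order from above, and a lifted basis of G/Q generates the group because the exponent is
  a power of two.\<close>

lemma card_involutions:
  assumes fin: "finite (carrier G)" and exp: "\<And>x. x \<in> carrier G \<Longrightarrow> x [^] (2 ^ k :: nat) = \<one>"
  shows "card {x \<in> carrier G. x \<otimes> x = \<one>} = 2 ^ group_rank G"
proof -
  let ?E = "{x \<in> carrier G. x \<otimes> x = \<one>}" and ?Q = "(\<lambda>x. x \<otimes> x) ` carrier G"
  have "x \<otimes> x = y \<otimes> y \<longleftrightarrow> x \<otimes> inv y \<in> ?E" if "x \<in> carrier G" "y \<in> carrier G" for x y
  proof -
    have "(x \<otimes> inv y) \<otimes> (x \<otimes> inv y) = (x \<otimes> x) \<otimes> inv (y \<otimes> y)"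
      using that by (simp add: inv_mult m_ac)
    moreover have "(x \<otimes> x) \<otimes> inv (y \<otimes> y) = \<one> \<longleftrightarrow> x \<otimes> x = y \<otimes> y"
      using that inv_solve_right[of \<one> "x \<otimes> x" "y \<otimes> y"] by (metis l_one m_closed one_closed)
    ultimately show ?thesis using that by simp
  qed
  then have EQ: "card (carrier G) = card ?Q * card ?E"
    by (intro card_eq_index_mult subgroup_self fin subgroup_involutions) auto
  have Q0: "0 < card ?Q" using fin by (auto simp: card_gt_0_iff)
  have sqQ: "x \<otimes> x \<in> ?Q" if "x \<in> carrier G" for x using that by auto
  let ?R = "\<lambda>n. \<exists>S. S \<subseteq> carrier G \<and> finite S \<and> card S = n \<and> generate G S = carrier G"
  \<comment> \<open>The carrier generates itself, so the minimum in \<open>group_rank\<close> is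
    attained.\<close>
  have "?R (card (carrier G))"
    using fin generate_incl[of "carrier G"] generate.incl[of _ "carrier G" G]
    by (intro exI[of _ "carrier G"]) blast
  then have "?R (group_rank G)" unfolding group_rank_def by (rule LeastI)
  then obtain S where S: "S \<subseteq> carrier G" "finite S" "card S = group_rank G" "generate G S = carrier G"
    by blast
  have "card ?Q * card ?E \<le> 2 ^ group_rank G * card ?Q"
    using card_le_generating_set[OF fin subgroup_squares sqQ S(2,1,4)] S(3) EQ by simp
  then have le: "card ?E \<le> 2 ^ group_rank G" using Q0 by (simp add: mult.commute)
  obtain n and x :: "nat \<Rightarrow> 'a" where x: "x ` {1..n} \<subseteq> carrier G"
    and n: "card (carrier G) = 2 ^ n * card ?Q"
    and gen: "\<And>g. g \<in> carrier G \<Longrightarrow> \<exists>h\<in>generate G (x ` {1..n}). \<exists>q\<in>?Q. g = h \<otimes> q"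
    using exists_independent_generators[OF fin subgroup_squares sqQ] by blast
  have "generate G (x ` {1..n}) = carrier G"
    by (rule generate_eq_carrier_of_mod_squares[OF x exp]) (use gen in blast)+
  then have "?R (card (x ` {1..n}))" using x by blast
  then have "group_rank G \<le> card (x ` {1..n})" unfolding group_rank_def by (rule Least_le)
  also have "\<dots> \<le> n" using card_image_le[of "{1..n}" x] by simp
  finally have "(2::nat) ^ group_rank G \<le> 2 ^ n" by simp
  also have "2 ^ n = card ?E" using n EQ Q0 by simp
  finally show ?thesis using le by simp
qed

lemma group_exponent_works:
  assumes fin: "finite (carrier G)"
  shows "0 < group_exponent G \<and> (\<forall>g\<in>carrier G. g [^] group_exponent G = \<one>)"
proof -
  have "0 < order G" using fin by (simp add: order_gt_0_iff_finite)
  then show ?thesis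
    unfolding group_exponent_def
    by (intro LeastI[of "\<lambda>n. 0 < n \<and> (\<forall>g\<in>carrier G. g [^] n = \<one>)" "order G"])
      (auto intro: pow_order_eq_1)
qed

text \<open>The exponent is bounded only in size; divisibility comes from the order of
  \<open>g\<close>, a power of two that is at most 2^m.\<close>

lemma nat_pow_two_power_eq_one:
  assumes fin: "finite (carrier G)" and ord: "order G = 2 ^ k"
    and exp: "group_exponent G \<le> 2 ^ m" and g: "g \<in> carrier G"
  shows "g [^] (2 ^ m :: nat) = \<one>"
proof -
  have "ord g dvd 2 ^ k" using ord_dvd_group_order[OF g] ord by simp
  then obtain j where j: "ord g = 2 ^ j" by (auto simp: divides_primepow_nat)
  have "0 < group_exponent G" using group_exponent_works[OF fin] by blast
  moreover have "ord g dvd group_exponent G"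
    using group_exponent_works[OF fin] g pow_eq_id[OF g] by blast
  ultimately have "(2::nat) ^ j \<le> 2 ^ m" using j exp by (metis dvd_imp_le le_trans)
  then have "j \<le> m" by simp
  then have "ord g dvd 2 ^ m" unfolding j by (rule le_imp_power_dvd)
  then show ?thesis using pow_eq_id[OF g] by blast
qed

subsection \<open>Signature blocks\<close>

lemma exists_coset_representatives:
  assumes E: "subgroup E G"
  shows "\<exists>T. coset_representatives G E T"
proof -
  define t where "t = (\<lambda>C. SOME x. x \<in> (C :: 'a set))"
  have t: "t C \<in> C" if "C \<in> rcosets E" for C
  proof -
    have "C \<noteq> {}" using subgroup.rcosets_non_empty[OF E that] .
    then show ?thesis unfolding t_def by (rule some_in_eq[THEN iffD2])
  qed
  have "coset_representatives G E (t ` (rcosets E))"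
    unfolding coset_representatives_def
  proof (intro conjI ballI)
    show "t ` (rcosets E) \<subseteq> carrier G"
      using t subgroup.rcosets_carrier[OF E is_group] by blast
    fix C assume C: "C \<in> rcosets E"
    show "\<exists>!x. x \<in> t ` (rcosets E) \<inter> C"
    proof (rule ex1I[of _ "t C"])
      show "t C \<in> t ` (rcosets E) \<inter> C" using t C by blast
      fix x assume "x \<in> t ` (rcosets E) \<inter> C"
      then obtain D where D: "D \<in> rcosets E" "x = t D" "x \<in> C" by blast
      then have "D = C" using t[of D] rcos_disjoint[OF E] C by (auto simp: pairwise_def disjnt_def)
      then show "x = t C" using D by simp
    qed
  qed
  then show ?thesis by blast
qed

lemma sum_eq_sum_coset_representatives:
  fixes g :: "'a \<Rightarrow> int"
  assumes fin: "finite (carrier G)" and E: "subgroup E G" and T: "coset_representatives G E T"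
    and inv: "\<And>p x. p \<in> E \<Longrightarrow> x \<in> carrier G \<Longrightarrow> g (p \<otimes> x) = g x"
  shows "(\<Sum>x\<in>carrier G. g x) = int (card E) * (\<Sum>t\<in>T. g t)"
proof -
  interpret E: subgroup E G by fact
  have TG: "T \<subseteq> carrier G" and ex1: "\<And>C. C \<in> rcosets E \<Longrightarrow> \<exists>!t. t \<in> T \<inter> C"
    using T by (auto simp: coset_representatives_def)
  have finE: "finite (E #> t)" for t using fin E.subset by (auto simp: r_coset_def intro: finite_subset)
  have "(\<Union>t\<in>T. E #> t) = carrier G"
  proof
    show "(\<Union>t\<in>T. E #> t) \<subseteq> carrier G" using TG r_coset_subset_G[OF E.subset] by blast
    show "carrier G \<subseteq> (\<Union>t\<in>T. E #> t)"
    proof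
      fix x assume x: "x \<in> carrier G"
      then obtain t where t: "t \<in> T" "t \<in> E #> x" using ex1[OF rcosetsI[OF E.subset x]] by blast
      then have "E #> x = E #> t" using repr_independence[OF _ x E] by blast
      then show "x \<in> (\<Union>t\<in>T. E #> t)" using rcos_self[OF x E] t(1) by blast
    qed
  qed
  moreover have "(E #> s) \<inter> (E #> t) = {}" if "s \<in> T" "t \<in> T" "s \<noteq> t" for s t
  proof (rule ccontr)
    assume "(E #> s) \<inter> (E #> t) \<noteq> {}"
    then obtain x where x: "x \<in> E #> s" "x \<in> E #> t" by blast
    have st: "s \<in> carrier G" "t \<in> carrier G" using that TG by auto
    then have "E #> s = E #> t" using repr_independence[OF x(1) _ E] repr_independence[OF x(2) _ E] by simp
    then have "s \<in> T \<inter> (E #> t)" "t \<in> T \<inter> (E #> t)" using rcos_self[OF _ E] st that by auto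
    then show False using ex1[OF rcosetsI[OF E.subset st(2)]] that(3) by blast
  qed
  ultimately have "(\<Sum>x\<in>carrier G. g x) = (\<Sum>t\<in>T. \<Sum>x\<in>E #> t. g x)"
    using sum.UNION_disjoint[of T "\<lambda>t. E #> t" g] finE finite_subset[OF TG fin] by auto
  also have "\<dots> = (\<Sum>t\<in>T. int (card E) * g t)"
  proof (rule sum.cong[OF refl])
    fix t assume "t \<in> T"
    then have t: "t \<in> carrier G" using TG by auto
    have "(\<Sum>x\<in>E #> t. g x) = (\<Sum>x\<in>E #> t. g t)"
      by (rule sum.cong[OF refl]) (use inv t in \<open>auto simp: r_coset_def\<close>)
    then show "(\<Sum>x\<in>E #> t. g x) = int (card E) * g t"
      using card_r_coset[OF E.subset t] by simp
  qed
  finally show ?thesis by (simp add: sum_distrib_left)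
qed

text \<open>Multiplying \<open>A\<close> by \<open>\<psi>\<close> rebuilds \<open>f\<close> from its
  values on the transversal; multiplying by \<open>gr_inv G A\<close> then gives the correlation of
  \<open>f\<close> over \<open>T\<close>, which is the full autocorrelation divided by
  \<open>card E\<close>.\<close>

lemma perfect_function_restrict:
  assumes fin: "finite (carrier G)" and \<psi>: "sign_character G E \<psi>"
    and f: "perfect_function G (carrier G) E \<psi> f"
    and T: "coset_representatives G E T"
  defines "A \<equiv> \<lambda>g. if g \<in> T then f g else 0"
  shows "A \<otimes>\<^bsub>group_ring G\<^esub> \<psi> \<otimes>\<^bsub>group_ring G\<^esub> gr_inv G A =
    (\<lambda>g. int (card (carrier G) div card E) * \<psi> g)"
proof -
  have E: "subgroup E G" and sg: "\<And>p. p \<in> E \<Longrightarrow> \<psi> p \<in> {1, -1}"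
    and off: "\<And>x. x \<notin> E \<Longrightarrow> \<psi> x = 0"
    using \<psi> by (auto simp: sign_character_def)
  interpret E: subgroup E G by fact
  have fE: "\<And>p x. p \<in> E \<Longrightarrow> x \<in> carrier G \<Longrightarrow> f (p \<otimes> x) = \<psi> p * f x"
    and val: "\<And>x. x \<in> carrier G \<Longrightarrow> f x \<in> {1, -1}"
    and cor: "\<And>y. y \<in> carrier G - E \<Longrightarrow> (\<Sum>x\<in>carrier G. f x * f (x \<otimes> y)) = 0"
    using f by (auto simp: perfect_function_def)
  have TG: "T \<subseteq> carrier G" and ex1: "\<And>C. C \<in> rcosets E \<Longrightarrow> \<exists>!t. t \<in> T \<inter> C"
    using T by (auto simp: coset_representatives_def)
  have finT: "finite T" using TG fin finite_subset by auto
  have A: "A \<in> carrier (group_ring G)" using TG by (auto simp: group_ring_carrier_iff[OF fin] A_def)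
  have \<psi>c: "\<psi> \<in> carrier (group_ring G)"
    using off E.subset by (auto simp: group_ring_carrier_iff[OF fin])
  have iA: "gr_inv G A \<in> carrier (group_ring G)"
    by (simp add: group_ring_carrier_iff[OF fin] gr_inv_def)
  have sumA: "(\<Sum>h\<in>carrier G. A h * c h) = (\<Sum>h\<in>T. f h * c h)" for c :: "'a \<Rightarrow> int"
    by (rule sum.mono_neutral_cong_right) (use fin TG in \<open>auto simp: A_def\<close>)
  define F where "F = (\<lambda>g. if g \<in> carrier G then f g else 0)"
  have F: "F \<in> carrier (group_ring G)" by (simp add: group_ring_carrier_iff[OF fin] F_def)
  \<comment> \<open>Only the representative \<open>t\<close> of the coset of \<open>g\<close>
    contributes, and equivariance turns its term into \<open>f g\<close>.\<close>
  have "A \<otimes>\<^bsub>group_ring G\<^esub> \<psi> = F"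
  proof
    fix g
    have "(\<Sum>h\<in>T. f h * \<psi> (inv h \<otimes> g)) = f g" if g: "g \<in> carrier G"
    proof -
      have iff: "inv h \<otimes> g \<in> E \<longleftrightarrow> h \<in> E #> g" if h: "h \<in> carrier G" for h
      proof -
        have "h \<in> E #> g \<longleftrightarrow> E #> g = E #> h"
          using repr_independence[OF _ g E] rcos_self[OF h E] by blast
        also have "\<dots> \<longleftrightarrow> inv h \<otimes> g \<in> E"
          unfolding r_coset_eq_iff[OF E g h] using m_comm[of g "inv h"] g h by simp
        finally show ?thesis by simp
      qed
      obtain t where t: "t \<in> T" "t \<in> E #> g" and uniq: "\<And>s. s \<in> T \<Longrightarrow> s \<in> E #> g \<Longrightarrow> s = t"
        using ex1[OF rcosetsI[OF E.subset g]] by blast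
      have tG: "t \<in> carrier G" using t TG by auto
      have "(\<Sum>h\<in>T. f h * \<psi> (inv h \<otimes> g)) = (\<Sum>h\<in>{t}. f h * \<psi> (inv h \<otimes> g))"
      proof (rule sum.mono_neutral_right[OF finT])
        show "\<forall>h\<in>T - {t}. f h * \<psi> (inv h \<otimes> g) = 0"
        proof
          fix h assume h: "h \<in> T - {t}"
          then have "h \<notin> E #> g" using uniq by blast
          then have "inv h \<otimes> g \<notin> E" using iff h TG by blast
          then show "f h * \<psi> (inv h \<otimes> g) = 0" by (simp add: off)
        qed
      qed (use t in simp)
      also have "\<dots> = f ((inv t \<otimes> g) \<otimes> t)"
        using fE[of "inv t \<otimes> g" t] iff[OF tG] t tG by simp
      also have "(inv t \<otimes> g) \<otimes> t = g" using g tG by (simp add: m_comm[of "inv t \<otimes> g" t] m_assoc[symmetric])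
      finally show ?thesis .
    qed
    then show "(A \<otimes>\<^bsub>group_ring G\<^esub> \<psi>) g = F g"
      unfolding group_ring_mult_apply[OF fin A \<psi>c] sumA F_def by simp
  qed
  moreover have "(F \<otimes>\<^bsub>group_ring G\<^esub> gr_inv G A) g = int (card (carrier G) div card E) * \<psi> g" for g
  proof (cases "g \<in> carrier G")
    case False
    then show ?thesis using off[of g] E.subset unfolding group_ring_mult_apply[OF fin F iA] by auto
  next
    case g: True
    let ?S = "\<Sum>x\<in>T. f x * f (x \<otimes> g)"
    have "(F \<otimes>\<^bsub>group_ring G\<^esub> gr_inv G A) g = (\<Sum>h\<in>carrier G. F h * gr_inv G A (inv h \<otimes> g))"
      unfolding group_ring_mult_apply[OF fin F iA] using g by simp
    \<comment> \<open>Substituting \<open>g \<otimes> x\<close> for \<open>h\<close> leaves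
      \<open>inv x\<close> as the argument of \<open>gr_inv G A\<close>, so the convolution becomes
      a correlation.\<close>
    also have "\<dots> = (\<Sum>x\<in>carrier G. F (g \<otimes> x) * gr_inv G A (inv (g \<otimes> x) \<otimes> g))"
      by (rule sum_carrier_translate[OF g, symmetric])
    also have "\<dots> = (\<Sum>x\<in>carrier G. A x * f (x \<otimes> g))"
    proof (rule sum.cong[OF refl])
      fix x assume x: "x \<in> carrier G"
      have "inv (g \<otimes> x) \<otimes> g = inv x" using x g by (simp add: inv_mult_group m_assoc)
      then show "F (g \<otimes> x) * gr_inv G A (inv (g \<otimes> x) \<otimes> g) = A x * f (x \<otimes> g)"
        using x g by (simp add: F_def gr_inv_def m_comm mult.commute)
    qed
    also have "\<dots> = ?S" by (rule sumA)
    finally have conv: "(F \<otimes>\<^bsub>group_ring G\<^esub> gr_inv G A) g = ?S" .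
    \<comment> \<open>The summand is constant on cosets of \<open>E\<close>, since the sign
      \<open>\<psi> p\<close> enters twice.\<close>
    have "(\<Sum>x\<in>carrier G. f x * f (x \<otimes> g)) = int (card E) * ?S"
    proof (rule sum_eq_sum_coset_representatives[OF fin E T])
      fix p x assume p: "p \<in> E" and x: "x \<in> carrier G"
      have "\<psi> p * \<psi> p = 1" using sg[OF p] by (rule sign_square)
      moreover have "f (p \<otimes> x \<otimes> g) = \<psi> p * f (x \<otimes> g)" using fE[OF p, of "x \<otimes> g"] x g p by (simp add: m_assoc)
      ultimately show "f (p \<otimes> x) * f (p \<otimes> x \<otimes> g) = f x * f (x \<otimes> g)"
        using fE[OF p x] by (simp add: algebra_simps)
    qed
    moreover have "(\<Sum>x\<in>carrier G. f x * f (x \<otimes> g)) = int (card (carrier G)) * \<psi> g"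
    proof (cases "g \<in> E")
      case True
      have "f x * f (x \<otimes> g) = \<psi> g" if x: "x \<in> carrier G" for x
      proof -
        have "f x * f x = 1" using val[OF x] by (rule sign_square)
        then show ?thesis using fE[OF True x] x g by (simp add: m_comm[of x g] mult.left_commute)
      qed
      then show ?thesis by simp
    next
      case False
      then show ?thesis using cor[of g] off g by simp
    qed
    moreover have "card E dvd card (carrier G)"
      by (rule card_subgroup_dvd[OF subgroup_self fin E E.subset])
    moreover have "card E \<noteq> 0"
      using finite_subset[OF E.subset fin] E.one_closed by (metis card_0_eq empty_iff)
    ultimately have "?S = int (card (carrier G) div card E) * \<psi> g" by (auto simp: dvd_def)
    then show ?thesis using conv by simp
  qed
  ultimately show ?thesis by auto
qed

end

section \<open>The elementary abelian subgroup and the final assembly\<close>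

lemma (in group) card_C2_power_subgroup:
  assumes "C2_power_subgroup G r E"
  shows "subgroup E G" and "card E = 2 ^ r" and "\<And>x. x \<in> E \<Longrightarrow> x \<otimes> x = \<one>"
proof -
  show E: "subgroup E G" using assms by (simp add: C2_power_subgroup_def)
  interpret E: subgroup E G by fact
  have iso: "G\<lparr>carrier := E\<rparr> \<cong> C2_power r" using assms by (simp add: C2_power_subgroup_def)
  show "card E = 2 ^ r"
    using iso_same_card[OF iso] by (simp add: C2_power_def carrier_integer_mod_group card_PiE)
  obtain h where h: "h \<in> iso (G\<lparr>carrier := E\<rparr>) (C2_power r)" using iso by (auto simp: is_iso_def)
  have hom: "h (x \<otimes> y) = h x \<otimes>\<^bsub>C2_power r\<^esub> h y" if "x \<in> E" "y \<in> E" for x y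
    using h that by (auto simp: iso_def hom_def)
  have inj: "inj_on h E" using h by (auto simp: iso_def bij_betw_def)
  have sq: "v \<otimes>\<^bsub>C2_power r\<^esub> v = \<one>\<^bsub>C2_power r\<^esub>" for v
    by (auto simp: C2_power_def restrict_def)
  fix x assume x: "x \<in> E"
  have "h (x \<otimes> x) = h (\<one> \<otimes> \<one>)" using hom[OF x x] hom[OF E.one_closed E.one_closed] sq by simp
  then show "x \<otimes> x = \<one>" using inj x by (auto dest!: inj_onD)
qed

text \<open>As \<open>chi\<close> depends on the tuple \<open>x\<close>, blocks are provided for
  every tuple of \<open>r\<close> elements generating \<open>E\<close>. The subtractions of natural
  numbers are exact because \<open>r\<close> is at most \<open>d + 1\<close>.\<close>

theorem theorem3p1:
  fixes K :: "('a, 'b) monoid_scheme" and d r :: nat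
  assumes "1 \<le> d" and "2 \<le> r" and "r \<le> d + 1"
    and "comm_group K"
    and "order K = 2 ^ (2 * d + 2 - r)"
    and "group_rank K = r"
    and "group_exponent K \<le> 2 ^ (d + 2 - r)"
  shows "(\<exists>!E. C2_power_subgroup K r E) \<and>
    (\<forall>E x. C2_power_subgroup K r E \<and> x ` {1..r} \<subseteq> carrier K \<and> generate K (x ` {1..r}) = E
       \<longrightarrow> (\<exists>M. signature_set K E r x M))"
proof -
  interpret comm_group K by fact
  have fin: "finite (carrier K)" using assms(5) order_gt_0_iff_finite by simp
  define E where "E = {g \<in> carrier K. g \<otimes>\<^bsub>K\<^esub> g = \<one>\<^bsub>K\<^esub>}"
  \<comment> \<open>\<open>E\<close> is made a group in its own right because \<open>chi\<close> is
    a product in its group ring.\<close>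
  define H where "H = K\<lparr>carrier := E\<rparr>"
  have exp: "g [^]\<^bsub>K\<^esub> (2 ^ (d + 2 - r) :: nat) = \<one>\<^bsub>K\<^esub>" if "g \<in> carrier K" for g
    by (rule nat_pow_two_power_eq_one[OF fin assms(5,7) that])
  have E: "subgroup E K" unfolding E_def by (rule subgroup_involutions)
  have cardE: "card E = 2 ^ r"
    unfolding E_def assms(6)[symmetric] by (rule card_involutions[OF fin exp])
  have finE: "finite E" using fin by (simp add: E_def)
  interpret H: comm_group H unfolding H_def
    by (rule group.group_comm_groupI[OF subgroup.subgroup_is_group[OF E is_group]])
      (use m_comm in \<open>auto simp: E_def\<close>)
  have Hfin: "finite (carrier H)" and Hcard: "card (carrier H) = 2 ^ r" and HE: "carrier H = E"
    using finE cardE by (auto simp: H_def)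
  have Hsq: "g \<otimes>\<^bsub>H\<^esub> g = \<one>\<^bsub>H\<^esub>" if "g \<in> carrier H" for g using that by (simp add: H_def E_def)
  have C2E: "C2_power_subgroup K r E"
  proof -
    \<comment> \<open>Independent generators modulo the trivial subgroup form a basis of
      \<open>E\<close>; counting forces \<open>n = r\<close>.\<close>
    obtain n and y :: "nat \<Rightarrow> 'a" where y: "y ` {1..n} \<subseteq> carrier H"
      and n: "card (carrier H) = 2 ^ n * card {\<one>\<^bsub>H\<^esub>}"
      and gen: "\<And>g. g \<in> carrier H \<Longrightarrow> \<exists>h\<in>generate H (y ` {1..n}). \<exists>q\<in>{\<one>\<^bsub>H\<^esub>}. g = h \<otimes>\<^bsub>H\<^esub> q"
      using H.exists_independent_generators[OF Hfin H.triv_subgroup] Hsq by blast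
    have inc: "generate H (y ` {1..n}) \<subseteq> carrier H" by (rule H.generate_incl[OF y])
    have "generate H (y ` {1..n}) = carrier H"
      using gen inc by (fastforce dest: subsetD)
    then have "C2_power n \<cong> H" using H.C2_power_iso[OF Hfin Hsq y] n by simp
    moreover have "n = r" using n Hcard by simp
    moreover have "group (C2_power r)" by (simp add: C2_power_def)
    ultimately have "H \<cong> C2_power r" using group.iso_sym by blast
    then show ?thesis using E by (simp add: C2_power_subgroup_def H_def)
  qed
  \<comment> \<open>Every element of \<open>E'\<close> squares to the identity, so \<open>E'\<close>
    lies in \<open>E\<close>, and both have order 2^r.\<close>
  have uniq: "E' = E" if "C2_power_subgroup K r E'" for E'
  proof (rule card_subset_eq[OF finE])
    show "E' \<subseteq> E" using card_C2_power_subgroup[OF that] subgroup.subset by (fastforce simp: E_def)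
    show "card E' = card E" using card_C2_power_subgroup(2)[OF that] cardE by simp
  qed
  have "\<exists>M. signature_set K E r x M"
    if x: "x ` {1..r} \<subseteq> carrier K" "generate K (x ` {1..r}) = E" for x
  proof -
    have xE: "x ` {1..r} \<subseteq> carrier H" using x generate.incl[of _ "x ` {1..r}" K] by (auto simp: HE)
    have genH: "generate H (x ` {1..r}) = carrier H"
      using generate_consistent[OF _ E, of "x ` {1..r}"] xE x by (simp add: H_def)
    \<comment> \<open>The tuple \<open>x\<close> is independent because its \<open>r\<close> entries
      generate a group of order 2^r.\<close>
    have chi: "sign_character K E (chi K E r x u)" for u
    proof -
      have "sign_character H (generate H (x ` {1..r})) (chi K E r x u)"
        using H.sign_character_finprod[OF Hfin Hsq _ xE, of "\<lambda>i. (- 1) ^ of_bool (u i = 1)"]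
          H.independent_of_card_generate[OF Hfin Hsq _ xE genH] Hcard
        by (simp add: chi_def H_def of_bool_def)
      then show ?thesis unfolding genH HE using E by (simp add: sign_character_def H_def)
    qed
    obtain T where T: "coset_representatives K E T" using exists_coset_representatives[OF E] by blast
    have "\<exists>A. signature_block K E r x u A" for u
    proof -
      \<comment> \<open>The induction parameter is d + 1 - r, since 2d + 2 - r is twice this number
        plus \<open>r\<close>.\<close>
      have ratio: "card (carrier K) = 4 ^ (d + 1 - r) * card E"
      proof -
        have "2 * d + 2 - r = 2 * (d + 1 - r) + r" using assms(3) by simp
        then show ?thesis using assms(5) cardE by (simp add: order_def power_add power_mult)
      qed
      \<comment> \<open>The square of this power is the 2^(d+2-r)-th power of \<open>g\<close>,
        which is trivial by the exponent bound.\<close>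
      have "g [^]\<^bsub>K\<^esub> (2 ^ (d + 1 - r) :: nat) \<in> E" if g: "g \<in> carrier K" for g
      proof -
        have "d + 2 - r = Suc (d + 1 - r)" using assms(3) by simp
        then show ?thesis using exp[OF g] g by (simp add: E_def nat_pow_mult mult_2)
      qed
      then obtain f where f: "perfect_function K (carrier K) E (chi K E r x u) f"
        using exists_perfect_function[OF subgroup_self fin subgroup.subset[OF E] chi ratio] by blast
      have TK: "T \<subseteq> carrier K" using T by (simp add: coset_representatives_def)
      let ?A = "\<lambda>g. if g \<in> T then f g else 0"
      have "signature_block K E r x u ?A"
        unfolding signature_block_def
      proof (intro conjI exI[of _ T])
        show "?A \<in> carrier (group_ring K)" using TK by (auto simp: group_ring_carrier_iff[OF fin])
        show "\<forall>g\<in>T. ?A g \<in> {1, - 1}" using f TK by (auto simp: perfect_function_def)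
        show "?A \<otimes>\<^bsub>group_ring K\<^esub> chi K E r x u \<otimes>\<^bsub>group_ring K\<^esub> gr_inv K ?A =
            (\<lambda>g. int (order K div 2 ^ r) * chi K E r x u g)"
          using perfect_function_restrict[OF fin chi f T] by (simp add: order_def cardE)
      qed (use T in auto)
      then show ?thesis by blast
    qed
    then obtain A where "\<And>u. signature_block K E r x u (A u)" by metis
    then show ?thesis unfolding signature_set_def by blast
  qed
  then show ?thesis using C2E uniq by blast
qed

end
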